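(* There is a randomized distributed algorithm for the maximal independent set (MIS) problem in the $\mathsf{CONGEST}$ model with time complexity $O(\log^2 n)$ and energy complexity $O(\log\log n)$. That is, on any $n$-node graph $G$ the algorithm runs for $O(\log^2 n)$ rounds, each node is awake in only $O(\log\log n)$ rounds, and the algorithm computes an independent set of vertices of $G$ which, with high probability, is maximal.
   Context: The network is an $n$-node undirected graph $G=(V,E)$; each node is a processor that initially knows only its neighbors (and a polynomial upper bound on $n$). Computation proceeds in synchronous rounds; in the $\mathsf{CONGEST}$ model, in each round every node may perform local computation and send one message of $O(\log n)$ bits to each neighbor. In every round each node is either awake or sleeping; a sleeping node performs no computation and sends/receives no messages, and it wakes only at times it has scheduled itself. The time complexity is the number of rounds until all nodes terminate; the energy complexity is the maximum over nodes of the number of rounds in which that node is awake. An independent set is a set of pairwise non-adjacent vertices; it is maximal if every vertex not in it has a neighbor in it. "With high probability" means with probability at least $1-n^{-c}$ for some constant $c>0$. At the end, each node must know whether it is in the computed set. *)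

theory Defs
  imports "HOL-Probability.Probability"
begin

text \<open>
  Synchronous distributed algorithms in the sleeping CONGEST model.
  Nodes carry unique identifiers (natural numbers); a graph is a finite vertex
  set V of identifiers with a symmetric irreflexive edge relation E on V.
  Local states are encoded as nat lists (any countable state space can be
  encoded), messages are bit strings.  Randomness enters through the
  (distribution-valued) initialisation and transition functions; the coins of
  different nodes are independent (product distribution).
\<close>

type_synonym lstate = "nat list"
type_synonym msg = "bool list"

record algorithm =
  a_init  :: "nat \<Rightarrow> nat set \<Rightarrow> lstate pmf"
    \<comment> \<open>initial state from own identifier and the set of neighbour identifiers\<close>
  a_wake  :: "lstate \<Rightarrow> nat option"
    \<comment> \<open>round in which the node is next awake (scheduled by itself); None = terminated\<close>
  a_send  :: "lstate \<Rightarrow> nat \<Rightarrow> msg option"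
    \<comment> \<open>message sent to the neighbour with the given identifier (None = no message)\<close>
  a_trans :: "nat \<Rightarrow> lstate \<Rightarrow> (nat \<Rightarrow> msg option) \<Rightarrow> lstate pmf"
    \<comment> \<open>local (randomised) computation: round number, state, received messages by sender\<close>
  a_out   :: "lstate \<Rightarrow> bool"

definition simple_graph :: "nat set \<Rightarrow> (nat \<Rightarrow> nat \<Rightarrow> bool) \<Rightarrow> bool" where
  "simple_graph V E \<longleftrightarrow> finite V \<and> (\<forall>u v. E u v \<longrightarrow> u \<in> V \<and> v \<in> V \<and> E v u \<and> u \<noteq> v)"

definition independent_set :: "nat set \<Rightarrow> (nat \<Rightarrow> nat \<Rightarrow> bool) \<Rightarrow> nat set \<Rightarrow> bool" where
  "independent_set V E I \<longleftrightarrow> I \<subseteq> V \<and> (\<forall>u\<in>I. \<forall>v\<in>I. \<not> E u v)"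

definition maximal_independent_set :: "nat set \<Rightarrow> (nat \<Rightarrow> nat \<Rightarrow> bool) \<Rightarrow> nat set \<Rightarrow> bool" where
  "maximal_independent_set V E I \<longleftrightarrow>
     independent_set V E I \<and> (\<forall>v\<in>V - I. \<exists>u\<in>I. E u v)"

text \<open>A configuration assigns to each node its local state together with the number
  of rounds in which it has been awake so far.\<close>
type_synonym config = "nat \<Rightarrow> lstate \<times> nat"

definition awake_in :: "algorithm \<Rightarrow> nat \<Rightarrow> lstate \<Rightarrow> bool" where
  "awake_in A r s \<longleftrightarrow> a_wake A s = Some r"

definition inbox :: "algorithm \<Rightarrow> nat set \<Rightarrow> (nat \<Rightarrow> nat \<Rightarrow> bool) \<Rightarrow> nat \<Rightarrow> config \<Rightarrow> nat \<Rightarrow> nat \<Rightarrow> msg option" where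
  "inbox A V E r c v u =
     (if u \<in> V \<and> E u v \<and> awake_in A r (fst (c u)) \<and> awake_in A r (fst (c v))
      then a_send A (fst (c u)) v else None)"

definition round_step :: "algorithm \<Rightarrow> nat set \<Rightarrow> (nat \<Rightarrow> nat \<Rightarrow> bool) \<Rightarrow> nat \<Rightarrow> config \<Rightarrow> config pmf" where
  "round_step A V E r c =
     Pi_pmf V undefined (\<lambda>v.
        if awake_in A r (fst (c v))
        then map_pmf (\<lambda>s'. (s', Suc (snd (c v)))) (a_trans A r (fst (c v)) (inbox A V E r c v))
        else return_pmf (c v))"

text \<open>Distribution of the configuration at the beginning of round r (rounds 0,1,2,...).\<close>
primrec exec :: "algorithm \<Rightarrow> nat set \<Rightarrow> (nat \<Rightarrow> nat \<Rightarrow> bool) \<Rightarrow> nat \<Rightarrow> config pmf" where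
  "exec A V E 0 = Pi_pmf V undefined (\<lambda>v. map_pmf (\<lambda>s. (s, 0)) (a_init A v {u \<in> V. E v u}))"
| "exec A V E (Suc r) = bind_pmf (exec A V E r) (round_step A V E r)"

definition congest :: "real \<Rightarrow> nat \<Rightarrow> algorithm \<Rightarrow> bool" where
  "congest B N A \<longleftrightarrow> (\<forall>s u m. a_send A s u = Some m \<longrightarrow> real (length m) \<le> B * log 2 (real N))"

definition output_set :: "algorithm \<Rightarrow> nat set \<Rightarrow> config \<Rightarrow> nat set" where
  "output_set A V c = {v \<in> V. a_out A (fst (c v))}"

end

theory Submission
  imports Defs "HOL-Real_Asymp.Real_Asymp"
begin

text \<open>
  Both phases of the algorithm process the nodes slot by slot: an undominated node joins in its slot
  unless an undominated neighbour has the same slot. If the slots are the leaves of a binary tree of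
  depth \<open>k = O(log log n)\<close> and every node wakes up only at its leaf and at the inorder numbers of the
  ancestors of the leaf, then any two nodes meet between their slots, so each node learns in time
  whether it is dominated.

  In the first phase the slots are random, with a probability that doubles after every
  \<open>\<Theta>(log n)\<close> slots. While the number of active neighbours (undominated, slot still to come) times this
  probability is at most \<open>1/4\<close>, a node with \<open>d\<close> active neighbours is dominated in a slot of hazard \<open>h\<close>
  with probability at least \<open>d h / 2\<close>. Hence the active degrees halve from one block of
  slots to the next, until they vanish. The same bound shows that
  \<open>(5/4) ^ X\<close>, where \<open>X\<close> counts the neighbours of a node that are undominated after their slot,
  stopped when the node is dominated, is a supermartingale. So the undominated nodes induce a graph
  of degree \<open>O(log n)\<close> with high probability.

  Two steps of Linial's colour reduction colour this graph with \<open>O(log\<^sup>2 n)\<close> colours, which are the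
  slots of the second phase. As no two neighbours share a colour, the second phase completes the set
  to a maximal one.
\<close>

text \<open>With only O(log log n) wake-ups, a node cannot take part in O(log n) successive trials:
  it gets a single try per phase, and must know when that try happens before it can schedule its
  wake-ups. Hence all randomness is spent at initialisation, the run is a deterministic function of
  the slots, and only the analysis exposes the slots one at a time by fresh coins. A node whose try
  collides with a neighbour's has no second chance in the first phase; such nodes are what the
  second phase is for. With \<open>l\<close> about the logarithm of the known bound
  \<open>N\<close>, their degrees are at most \<open>10 * l\<close>. Polynomials of degree
  \<open>l\<close> modulo \<open>q1\<close> take the identifiers to O(l^4) colours, those of degree
  3 modulo \<open>q2\<close> take these to O(l^2). The moduli must be primes within a constant
  factor of prescribed bounds, because \<open>2 ^ k\<close> slots have to hold the final colours and
  yet number only O(l^2), the time that the first phase needs anyway for \<open>l + 1\<close> blocks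
  of \<open>33 * l\<close> slots. Only maximality is left to chance; running time, energy and
  independence hold with certainty.\<close>

section \<open>Primes in short intervals\<close>

text \<open>The numbers \<open>1 / ((n + 1) * (n choose k))\<close> form the Leibniz harmonic triangle, in which each entry
  is a difference of entries of the previous column.\<close>
lemma multiple_dvd_Suc_times_binomial:
  fixes Q :: nat
  assumes "Q > 0" "\<And>j. 1 \<le> j \<Longrightarrow> j \<le> Suc n \<Longrightarrow> j dvd Q" "k \<le> n"
  shows "Suc n * (n choose k) dvd Q"
proof -
  have "\<exists>z::int. real Q / (real (Suc n) * real (n choose k)) = of_int z"
    using assms(2,3)
  proof (induction k arbitrary: n)
    case 0
    have "Suc n dvd Q" using "0.prems"(1)[of "Suc n"] by simp
    then obtain j where "Q = Suc n * j" unfolding dvd_def by blast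
    then have "real Q / (real (Suc n) * real (n choose 0)) = of_int (int j)"
      by (simp add: field_simps)
    then show ?case by blast
  next
    case (Suc k)
    then obtain m where n: "n = Suc m" by (cases n) auto
    obtain z1 where z1: "real Q / (real (Suc m) * real (m choose k)) = of_int z1"
      using Suc.IH[of m] Suc.prems n by (metis Suc_le_mono le_SucI)
    obtain z2 where z2: "real Q / (real (Suc n) * real (n choose k)) = of_int z2"
      using Suc.IH[of n] Suc.prems n by (metis Suc_leD)
    have km: "k \<le> m" using Suc.prems n by simp
    have pos: "real (m choose k) > 0" "real (n choose k) > 0" "real (n choose Suc k) > 0"
      using km n Suc.prems by (auto simp: zero_less_binomial simp del: binomial_Suc_Suc)
    have e1: "real (Suc k) * real (n choose Suc k) = real (Suc m) * real (m choose k)"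
      unfolding n using Suc_times_binomial_eq[of m k] by (metis mult.commute of_nat_mult)
    have e2: "real (n choose k) * (real (Suc m) - real k) = real (Suc m) * real (m choose k)"
    proof -
      have "(Suc m - k) * (Suc m choose k) = Suc m * (m choose k)"
        using binomial_absorb_comp[of "Suc m" k] by simp
      then have "real ((Suc m - k) * (Suc m choose k)) = real (Suc m * (m choose k))" by simp
      moreover have "real (Suc m - k) = real (Suc m) - real k" using km by (intro of_nat_diff) simp
      ultimately show ?thesis unfolding n of_nat_mult by (simp only: mult.commute)
    qed
    let ?a = "real (Suc m) * real (m choose k)"
    have p: "?a > 0" "real (Suc k) > 0" "real (Suc m) - real k > 0" using pos km by auto
    \<comment> \<open>Over the common denominator \<open>Suc n * (Suc m * (m choose k))\<close> the
      three entries have the numerators k + 1, m + 1 - k and n + 1, and k + 1 = (n + 1) - (m + 1 -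
      k) because n = m + 1.\<close>
    have i1: "1 / (real (Suc n) * real (n choose Suc k)) = real (Suc k) / (real (Suc n) * ?a)"
      unfolding e1[symmetric] by simp
    have i2: "1 / (real (Suc n) * real (n choose k)) = (real (Suc m) - real k) / (real (Suc n) * ?a)"
      unfolding e2[symmetric] using p by simp
    have i3: "1 / ?a = real (Suc n) / (real (Suc n) * ?a)" by (simp del: of_nat_Suc)
    have "1 / (real (Suc n) * real (n choose Suc k)) = 1 / ?a - 1 / (real (Suc n) * real (n choose k))"
      unfolding i1 i2 i3 diff_divide_distrib[symmetric] by (simp add: n)
    then have "real Q * (1 / (real (Suc n) * real (n choose Suc k))) =
        real Q * (1 / ?a) - real Q * (1 / (real (Suc n) * real (n choose k)))"
      by (simp only: right_diff_distrib)
    then have "real Q / (real (Suc n) * real (n choose Suc k)) = of_int (z1 - z2)"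
      using z1 z2 by simp
    then show ?case by blast
  qed
  then obtain z :: int where "real Q / (real (Suc n) * real (n choose k)) = of_int z" by blast
  moreover have "real (Suc n) * real (n choose k) \<noteq> 0" using assms by simp
  ultimately have "real Q = of_int z * (real (Suc n) * real (n choose k))" by (simp add: field_simps)
  then have "of_int (int Q) = (of_int (z * int (Suc n * (n choose k))) :: real)"
    unfolding of_int_mult of_int_of_nat_eq of_nat_mult .
  then have "int Q = z * int (Suc n * (n choose k))" by (simp only: of_int_eq_iff)
  then have "int (Suc n * (n choose k)) dvd int Q" by simp
  then show ?thesis by (simp only: int_dvd_int_iff)
qed

lemma prod_primes_dvd:
  fixes P :: "nat set"
  assumes "finite P" "\<And>p. p \<in> P \<Longrightarrow> prime p" "\<And>p. p \<in> P \<Longrightarrow> p dvd m"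
  shows "\<Prod>P dvd m"
  using assms
proof (induction P rule: finite_induct)
  case (insert p P)
  have "coprime p (\<Prod>P)"
    using insert by (intro prod_coprime_right) (metis insertCI primes_coprime)
  then show ?case using insert by (simp add: divides_mult)
qed auto

text \<open>Erdos's argument: for m = 2k + 1 the primes in (k + 1, m] all divide
  \<open>m choose k\<close>, which occurs twice in the row sum 2^m and is therefore at most 4^k. The
  primes up to k + 1 are left to the induction, and an even m > 2 adds no prime.\<close>

lemma primorial_le: "\<Prod>{p::nat. prime p \<and> p \<le> m} \<le> 4 ^ m"
proof (induction m rule: less_induct)
  case (less m)
  show ?case
  proof (cases "m \<le> 2")
    case True
    have "{p::nat. prime p \<and> p \<le> m} \<subseteq> {2}" using True by (auto dest: prime_ge_2_nat)
    then have "{p::nat. prime p \<and> p \<le> m} = {} \<or> {p::nat. prime p \<and> p \<le> m} = {2}" by auto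
    then have "\<Prod>{p::nat. prime p \<and> p \<le> m} = 1 \<or> (\<Prod>{p::nat. prime p \<and> p \<le> m} = 2 \<and> m \<ge> 2)"
    proof
      assume "{p::nat. prime p \<and> p \<le> m} = {2}"
      moreover from this have "2 \<in> {p::nat. prime p \<and> p \<le> m}" by (simp only: singletonI)
      then have "2 \<le> m" by simp
      ultimately show ?thesis by simp
    qed (simp only: prod.empty simp_thms)
    moreover have "(4::nat) ^ 2 \<le> 4 ^ m" if "m \<ge> 2" using that by (intro power_increasing) auto
    ultimately show ?thesis by auto
  next
    case False
    show ?thesis
    proof (cases "even m")
      case True
      have "\<not> prime m" using True False prime_odd_nat by (metis linorder_not_le)
      then have "p \<le> m - 1" if "prime p" "p \<le> m" for p using that by (cases "p = m") auto
      then have "{p::nat. prime p \<and> p \<le> m} = {p. prime p \<and> p \<le> m - 1}"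
        by (auto intro: order_trans[OF _ diff_le_self])
      then have "\<Prod>{p::nat. prime p \<and> p \<le> m} \<le> 4 ^ (m - 1)" using less[of "m - 1"] False by simp
      also have "\<dots> \<le> 4 ^ m" by (intro power_increasing) auto
      finally show ?thesis .
    next
      case odd: False
      then obtain k where k: "m = 2 * k + 1" by (auto elim: oddE)
      have k1: "k \<ge> 1" using False k by simp
      let ?A = "{p::nat. prime p \<and> p \<le> k + 1}" and ?B = "{p::nat. prime p \<and> k + 1 < p \<and> p \<le> m}"
      have "finite ?A" "finite ?B" by (auto intro: finite_subset[of _ "{..m}"] finite_subset[of _ "{..k+1}"])
      moreover have "{p::nat. prime p \<and> p \<le> m} = ?A \<union> ?B" using k k1 by auto
      moreover have "?A \<inter> ?B = {}" by auto
      ultimately have split: "\<Prod>{p::nat. prime p \<and> p \<le> m} = \<Prod>?A * \<Prod>?B"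
        by (simp add: prod.union_disjoint)
      have "\<Prod>?B dvd (m choose k)"
      proof (rule prod_primes_dvd)
        fix p assume p: "p \<in> ?B"
        have "fact k * fact (m - k) * (m choose k) = (fact m :: nat)"
          using binomial_fact_lemma[of k m] k by simp
        moreover have "p dvd (fact m :: nat)" using p by (simp add: prime_dvd_fact_iff)
        moreover have "\<not> p dvd (fact k :: nat)" "\<not> p dvd (fact (m - k) :: nat)"
          using p k by (auto simp: prime_dvd_fact_iff simp del: fact_Suc)
        ultimately show "p dvd (m choose k)" using p by (metis (lifting) mem_Collect_eq prime_dvd_mult_iff)
      qed (use \<open>finite ?B\<close> in auto)
      then have "\<Prod>?B \<le> (m choose k)" using k by (intro dvd_imp_le) auto
      also have "2 * (m choose k) = (m choose k) + (m choose (k + 1))"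
        using binomial_symmetric[of k m] k by simp
      also have "\<dots> = (\<Sum>i\<in>{k, k+1}. m choose i)" by simp
      then have "(m choose k) \<le> 4 ^ k"
      proof -
        have "(\<Sum>i\<in>{k, k+1}. m choose i) \<le> (\<Sum>i\<le>m. m choose i)" using k by (intro sum_mono2) auto
        also have "\<dots> = 2 ^ m" by (rule choose_row_sum)
        also have "\<dots> = 2 * 4 ^ k" using k by (simp add: power_mult)
        finally show ?thesis using \<open>2 * (m choose k) = (m choose k) + (m choose (k + 1))\<close> by simp
      qed
      finally have B: "\<Prod>?B \<le> 4 ^ k" using \<open>\<Prod>?B \<le> (m choose k)\<close> \<open>(m choose k) \<le> 4 ^ k\<close> by linarith
      have "\<Prod>?A \<le> 4 ^ (k + 1)" using less[of "k + 1"] k k1 by simp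
      then have "\<Prod>?A * \<Prod>?B \<le> 4 ^ (k + 1) * 4 ^ k" using B by (rule mult_le_mono)
      then show ?thesis unfolding split by (simp add: k power_add mult_2)
    qed
  qed
qed

text \<open>The product of all maximal prime powers up to \<open>m\<close> is the least common multiple of
  \<open>1, \<dots>, m\<close>; it is at least \<open>2 ^ (m - 1)\<close>, and without primes in \<open>(x, 4x]\<close> it would be too small.\<close>
lemma eventually_prime_between:
  "eventually (\<lambda>x::nat. \<exists>p. prime p \<and> x < p \<and> p \<le> 4 * x) at_top"
proof -
  \<comment> \<open>The logarithmic form of (4x)^(2 sqrt x) < 2^(2x - 1): the primes up to sqrt(4x)
    must not fill the gap between 4^x and 2^(4x - 1).\<close>
  have "eventually (\<lambda>x::nat. 2 * sqrt (real x) * ln (4 * real x) < (2 * real x - 1) * ln 2) at_top"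
    by real_asymp
  then show ?thesis
    using eventually_gt_at_top[of 1]
  proof eventually_elim
    case (elim x)
    show ?case
    proof (rule ccontr)
      assume no: "\<not> (\<exists>p. prime p \<and> x < p \<and> p \<le> 4 * x)"
      define m where "m = 4 * x"
      define P where "P = {p::nat. prime p \<and> p \<le> m}"
      have finP: "finite P" unfolding P_def by (rule finite_subset[of _ "{..m}"]) auto
      define e where "e p = Max {e. p ^ e \<le> m}" for p :: nat
      have fin: "finite {e. p ^ e \<le> m}" if "p \<in> P" for p
      proof (rule finite_subset[of _ "{..m}"])
        have "p \<ge> 2" using that prime_ge_2_nat by (auto simp: P_def)
        then have "e < p ^ e" for e by (metis less_le_trans less_exp power_mono zero_le)
        then show "{e. p ^ e \<le> m} \<subseteq> {..m}" by (auto intro: less_imp_le less_le_trans)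
      qed simp
      have m0: "m \<ge> 1" using elim m_def by simp
      have e: "p ^ e p \<le> m" "\<And>i. p ^ i \<le> m \<Longrightarrow> i \<le> e p" if "p \<in> P" for p
      proof -
        have "e p \<in> {e. p ^ e \<le> m}" unfolding e_def using fin[OF that] m0
          by (intro Max_in) (auto intro: exI[of _ 0])
        then show "p ^ e p \<le> m" by simp
        show "i \<le> e p" if "p ^ i \<le> m" for i unfolding e_def using fin[OF \<open>p \<in> P\<close>] that by (intro Max_ge) auto
      qed
      define Q where "Q = (\<Prod>p\<in>P. p ^ e p)"
      have Q0: "Q > 0" unfolding Q_def using prime_gt_0_nat by (intro prod_pos) (auto simp: P_def)
      have dvdQ: "j dvd Q" if j: "1 \<le> j" "j \<le> m" for j
      proof (rule multiplicity_le_imp_dvd)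
        fix p :: nat assume p: "prime p"
        show "multiplicity p j \<le> multiplicity p Q"
        proof (cases "p dvd j")
          case True
          then have "p \<in> P" using p j by (auto simp: P_def dest!: dvd_imp_le)
          have "p ^ multiplicity p j \<le> j" using j by (intro dvd_imp_le multiplicity_dvd) auto
          then have "multiplicity p j \<le> e p" using e(2)[OF \<open>p \<in> P\<close>] j by auto
          also have "e p = multiplicity p Q"
            unfolding Q_def using finP \<open>p \<in> P\<close> p
            by (subst multiplicity_prod_prime_powers) (auto simp: P_def)
          finally show ?thesis .
        qed (simp add: not_dvd_imp_multiplicity_0)
      qed (use j in auto)
      have low: "2 ^ (m - 1) \<le> Q"
      proof -
        have le: "m * (m - 1 choose k) \<le> Q" if "k \<le> m - 1" for k
          using multiple_dvd_Suc_times_binomial[of Q "m - 1" k] that dvdQ m0 Q0 by (simp add: dvd_imp_le)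
        have "m * 2 ^ (m - 1) = (\<Sum>k\<le>m - 1. m * (m - 1 choose k))"
          by (simp add: sum_distrib_left[symmetric] choose_row_sum)
        also have "\<dots> \<le> (\<Sum>k\<le>m - 1. Q)" by (intro sum_mono le) auto
        also have "\<dots> = m * Q" using m0 by simp
        finally show ?thesis using m0 by simp
      qed
      define s where "s = nat \<lfloor>sqrt (real m)\<rfloor>"
      have s: "p \<le> s" if "p\<^sup>2 \<le> m" for p
        using that unfolding s_def by (metis le_nat_floor of_nat_le_iff of_nat_power real_le_rsqrt)
      define A where "A = {p \<in> P. p\<^sup>2 \<le> m}"
      \<comment> \<open>A prime above sqrt m enters \<open>Q\<close> with exponent at most 1. For
        the smaller ones the prime power is bounded by \<open>m\<close>, and the spare factor
        \<open>p\<close> is kept so that the primorial splits off.\<close>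
      have "Q \<le> (\<Prod>p\<in>P. (if p\<^sup>2 \<le> m then m else 1) * p)"
        unfolding Q_def
      proof (intro prod_mono conjI)
        fix p assume p: "p \<in> P"
        have p2: "p \<ge> 2" using p prime_ge_2_nat by (auto simp: P_def)
        show "p ^ e p \<le> (if p\<^sup>2 \<le> m then m else 1) * p"
        proof (cases "p\<^sup>2 \<le> m")
          case True then show ?thesis using e(1)[OF p] p2 by (simp add: le_trans)
        next
          case False
          have "e p < 2"
          proof (rule ccontr)
            assume "\<not> e p < 2"
            then have "p ^ 2 \<le> p ^ e p" using p2 by (intro power_increasing) auto
            then show False using e(1)[OF p] False by simp
          qed
          then have "e p = 0 \<or> e p = 1" by auto
          then show ?thesis using p2 False by auto
        qed
      qed auto
      also have "\<dots> = (\<Prod>p\<in>P. if p\<^sup>2 \<le> m then m else 1) * \<Prod>P" by (simp add: prod.distrib)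
      also have "(\<Prod>p\<in>P. if p\<^sup>2 \<le> m then m else 1) = m ^ card A"
        unfolding A_def using finP by (simp add: prod.If_cases Int_def)
      also have "card A \<le> card {1..s}"
        using s prime_ge_1_nat by (intro card_mono) (auto simp: A_def P_def)
      then have "m ^ card A \<le> m ^ s" using m0 by (intro power_increasing) auto
      \<comment> \<open>The only use of the missing primes: the primorial shrinks from 4^(4x) to
        4^x.\<close>
      also have "P = {p. prime p \<and> p \<le> x}" using no by (auto simp: P_def m_def not_less)
      finally have "Q \<le> m ^ s * \<Prod>{p. prime p \<and> p \<le> x}" by (simp add: mult_le_mono1)
      also have "\<dots> \<le> m ^ s * 4 ^ x" by (intro mult_le_mono2 primorial_le)
      finally have "2 ^ (m - 1) \<le> m ^ s * 4 ^ x" using low by simp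
      then have "real (2 ^ (m - 1)) \<le> real (m ^ s * 4 ^ x)" by (simp only: of_nat_le_iff)
      also have "\<dots> = real m powr real s * 4 powr real x" using m0 by (simp add: powr_realpow)
      also have "\<dots> \<le> real m powr (sqrt (real m)) * 4 powr real x"
        using m0 unfolding s_def by (intro mult_right_mono powr_mono) (auto simp: of_nat_floor)
      also have "\<dots> = (4 * real x) powr (2 * sqrt (real x)) * 4 powr real x"
        by (simp add: m_def real_sqrt_mult)
      also have "(4 * real x) powr (2 * sqrt (real x)) < 2 powr (2 * real x - 1)"
        using elim by (simp add: powr_def)
      also have "2 powr (2 * real x - 1) * 4 powr real x = 2 powr (4 * real x - 1)"
      proof -
        have "(4::real) powr real x = (2 powr 2) powr real x" by simp
        also have "\<dots> = 2 powr (2 * real x)" by (simp only: powr_powr)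
        finally show ?thesis by (simp add: powr_add[symmetric])
      qed
      also have "\<dots> = real (2 ^ (m - 1))"
      proof -
        have "4 * real x - 1 = real (m - 1)" using m0 by (simp add: m_def of_nat_diff)
        then show ?thesis by (simp add: powr_realpow)
      qed
      finally show False by simp
    qed
  qed
qed

section \<open>Linial's colour reduction\<close>

text \<open>Lagrange's bound for the field of residues mod \<open>p\<close>, phrased with integer
  polynomials because the modulus is a variable of the algorithm and cannot be part of a type.
  Splitting off the factor of a root keeps the leading coefficient, so the condition on it survives
  the induction.\<close>

lemma card_roots_mod_prime_le:
  fixes f :: "int poly" and p :: int
  assumes "prime p" "\<not> p dvd lead_coeff f" "A \<subseteq> {0..<p}" "\<And>x. x \<in> A \<Longrightarrow> p dvd poly f x"
  shows "card A \<le> degree f"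
  using assms(2-)
proof (induction "degree f" arbitrary: f A)
  case 0
  then obtain c where c: "f = [:c:]" by (metis degree_eq_zeroE)
  have "A = {}" using "0.prems" c by auto
  then show ?case by simp
next
  case (Suc d)
  show ?case
  proof (cases "A = {}")
    case False
    then obtain a where a: "a \<in> A" by blast
    define g where "g = synthetic_div f a"
    have fg: "f = [:- a, 1:] * g + [:poly f a:]"
      unfolding g_def by (rule synthetic_div_correct'[symmetric])
    have dg: "degree g = d" unfolding g_def using Suc.hyps(2) by (simp add: degree_synthetic_div)
    have lg: "lead_coeff g = lead_coeff f"
    proof -
      have "coeff f (Suc d) = coeff ([:- a, 1:] * g) (Suc d)" by (subst fg) simp
      also have "\<dots> = coeff g d" using coeff_eq_0[of g "Suc d"] dg by simp
      finally show ?thesis using Suc.hyps(2) dg by simp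
    qed
    have "card (A - {a}) \<le> degree g"
    proof (rule Suc.hyps(1))
      show "d = degree g" using dg by simp
      show "\<not> p dvd lead_coeff g" using lg Suc.prems by simp
      show "A - {a} \<subseteq> {0..<p}" using Suc.prems by auto
      fix x assume x: "x \<in> A - {a}"
      have "poly f x = (x - a) * poly g x + poly f a" by (subst fg) (simp add: algebra_simps)
      then have "p dvd (x - a) * poly g x" using Suc.prems(3) x a by (metis DiffD1 dvd_add_left_iff)
      moreover have "\<not> p dvd x - a"
      proof
        assume "p dvd x - a"
        moreover have "x \<in> {0..<p}" "a \<in> {0..<p}" using x a Suc.prems by auto
        ultimately show False using x mod_eq_dvd_iff[of x p a] by auto
      qed
      ultimately show "p dvd poly g x" using assms(1) by (simp add: prime_dvd_mult_iff)
    qed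
    moreover have "finite A" using Suc.prems(2) finite_subset by blast
    ultimately show ?thesis using a dg Suc.hyps(2) by (simp add: card_Diff_singleton_if)
  qed simp
qed

text \<open>The polynomial over the residues mod \<open>q\<close> whose coefficients are the lowest
  \<open>d + 1\<close> base-\<open>q\<close> digits of the colour \<open>a\<close>; distinct colours
  below \<open>q ^ Suc d\<close> give distinct polynomials.\<close>

definition digit_poly_eval :: "nat \<Rightarrow> nat \<Rightarrow> nat \<Rightarrow> nat \<Rightarrow> nat" where
  "digit_poly_eval q d a x = (\<Sum>i\<le>d. (a div q ^ i mod q) * x ^ i) mod q"

lemma digits_eqI:
  fixes a b q :: nat
  assumes "\<And>i. i \<le> d \<Longrightarrow> a div q ^ i mod q = b div q ^ i mod q" "a < q ^ Suc d" "b < q ^ Suc d"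
  shows "a = b"
  using assms
proof (induction d arbitrary: a b)
  case 0
  then show ?case using "0.prems"(1)[of 0] by simp
next
  case (Suc d)
  have q: "q > 0" using Suc.prems(2) by (cases q) auto
  have "a div q = b div q"
  proof (rule Suc.IH)
    show "a div q div q ^ i mod q = b div q div q ^ i mod q" if "i \<le> d" for i
      using Suc.prems(1)[of "Suc i"] that by (simp add: div_mult2_eq)
    show "a div q < q ^ Suc d" "b div q < q ^ Suc d"
      using Suc.prems(2,3) by (simp_all only: power_Suc2[of q "Suc d"] less_mult_imp_div_less)
  qed
  moreover have "a mod q = b mod q" using Suc.prems(1)[of 0] by simp
  ultimately show ?case by (metis div_mult_mod_eq)
qed

text \<open>The difference polynomial is nonzero, as \<open>d + 1\<close> digits determine the
  number, and its coefficients lie strictly between \<open>- q\<close> and \<open>q\<close>. So its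
  leading coefficient is not divisible by \<open>q\<close>, and the root bound applies.\<close>

lemma card_digit_poly_agree_le:
  assumes q: "prime q" and ab: "a \<noteq> b" "a < q ^ Suc d" "b < q ^ Suc d"
  shows "card {x\<in>{..<q}. digit_poly_eval q d a x = digit_poly_eval q d b x} \<le> d"
proof -
  define c where "c i = int (a div q ^ i mod q) - int (b div q ^ i mod q)" for i
  have q0: "q > 0" using q prime_gt_0_nat by blast
  have c_dvd: "c i = 0" if "int q dvd c i" for i
  proof -
    have "\<bar>c i\<bar> < int q" unfolding c_def using q0
      by (smt (verit) mod_less_divisor of_nat_0_le_iff of_nat_less_iff)
    then show ?thesis using that dvd_imp_le_int[of "c i" "int q"] by auto
  qed
  define f where "f = (\<Sum>i\<le>d. monom (c i) i)"
  have cf: "coeff f i = (if i \<le> d then c i else 0)" for i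
    unfolding f_def by (simp add: coeff_sum)
  have "f \<noteq> 0"
  proof
    assume "f = 0"
    then have "c i = 0" if "i \<le> d" for i using cf[of i] that by simp
    then have "a div q ^ i mod q = b div q ^ i mod q" if "i \<le> d" for i
      using that unfolding c_def by simp
    then show False using digits_eqI ab by blast
  qed
  have deg: "degree f \<le> d" by (rule degree_le) (simp add: cf)
  let ?A = "{x\<in>{..<q}. digit_poly_eval q d a x = digit_poly_eval q d b x}"
  have "card (int ` ?A) \<le> degree f"
  proof (rule card_roots_mod_prime_le)
    show "prime (int q)" using q by simp
    show "\<not> int q dvd lead_coeff f"
      using \<open>f \<noteq> 0\<close> c_dvd cf[of "degree f"] by (metis deg leading_coeff_0_iff)
    show "int ` ?A \<subseteq> {0..<int q}" by auto
    fix y assume "y \<in> int ` ?A"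
    then obtain x where x: "y = int x" "digit_poly_eval q d a x = digit_poly_eval q d b x" by auto
    have "int (\<Sum>i\<le>d. (a div q ^ i mod q) * x ^ i) mod int q = int (\<Sum>i\<le>d. (b div q ^ i mod q) * x ^ i) mod int q"
      using x(2) unfolding digit_poly_eval_def by (metis zmod_int)
    then have "int q dvd int (\<Sum>i\<le>d. (a div q ^ i mod q) * x ^ i) - int (\<Sum>i\<le>d. (b div q ^ i mod q) * x ^ i)"
      by (simp add: mod_eq_dvd_iff)
    also have "\<dots> = poly f y"
      by (simp add: f_def poly_sum poly_monom c_def x(1) sum_subtractf left_diff_distrib)
    finally show "int q dvd poly f y" .
  qed
  then show ?thesis using deg by (simp add: card_image)
qed

text \<open>One step of Linial's colour reduction: a node of colour \<open>a\<close> whose neighbours have the colours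
  \<open>S\<close> picks a point of the graph of its polynomial that is on no neighbour's graph.
  The result is junk if there is no such point.\<close>
definition linial_colour :: "nat \<Rightarrow> nat \<Rightarrow> nat \<Rightarrow> nat set \<Rightarrow> nat" where
  "linial_colour q d a S =
     (let x = (SOME x. x < q \<and> (\<forall>b\<in>S. digit_poly_eval q d a x \<noteq> digit_poly_eval q d b x))
      in x * q + digit_poly_eval q d a x)"

text \<open>Each neighbour's colour rules out at most \<open>d\<close> of the \<open>q\<close>
  points, so a point survives when \<open>card S * d < q\<close>.\<close>

lemma linial_colour_correct:
  assumes "prime q" "finite S" "card S * d < q" "a < q ^ Suc d" "\<And>b. b \<in> S \<Longrightarrow> b < q ^ Suc d" "a \<notin> S"
  obtains x where "x < q" "\<And>b. b \<in> S \<Longrightarrow> digit_poly_eval q d a x \<noteq> digit_poly_eval q d b x"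
    "linial_colour q d a S = x * q + digit_poly_eval q d a x"
proof -
  let ?P = "\<lambda>x. x < q \<and> (\<forall>b\<in>S. digit_poly_eval q d a x \<noteq> digit_poly_eval q d b x)"
  have "\<exists>x. ?P x"
  proof (rule ccontr)
    assume "\<nexists>x. ?P x"
    then have "{..<q} \<subseteq> (\<Union>b\<in>S. {x\<in>{..<q}. digit_poly_eval q d a x = digit_poly_eval q d b x})" by auto
    then have "card {..<q} \<le> card (\<Union>b\<in>S. {x\<in>{..<q}. digit_poly_eval q d a x = digit_poly_eval q d b x})"
      using assms(2) by (intro card_mono) auto
    also have "\<dots> \<le> (\<Sum>b\<in>S. card {x\<in>{..<q}. digit_poly_eval q d a x = digit_poly_eval q d b x})"
      by (rule card_UN_le) (rule assms)
    also have "\<dots> \<le> (\<Sum>b\<in>S. d)"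
      using assms by (intro sum_mono card_digit_poly_agree_le) auto
    finally show False using assms(3) by simp
  qed
  then have "?P (SOME x. ?P x)" by (rule someI_ex)
  then show ?thesis using that unfolding linial_colour_def Let_def by blast
qed

lemma digit_poly_eval_less: "q > 0 \<Longrightarrow> digit_poly_eval q d a x < q"
  unfolding digit_poly_eval_def by simp

lemma linial_colour_less:
  assumes "prime q" "finite S" "card S * d < q" "a < q ^ Suc d" "\<And>b. b \<in> S \<Longrightarrow> b < q ^ Suc d" "a \<notin> S"
  shows "linial_colour q d a S < q\<^sup>2"
proof -
  obtain x where x: "x < q" "linial_colour q d a S = x * q + digit_poly_eval q d a x"
    using linial_colour_correct[OF assms] by metis
  have "digit_poly_eval q d a x < q" using x digit_poly_eval_less by simp
  then have "x * q + digit_poly_eval q d a x < (x + 1) * q" by simp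
  also have "\<dots> \<le> q * q" using x by (intro mult_le_mono1) simp
  finally show ?thesis using x by (simp add: power2_eq_square)
qed

text \<open>Since the evaluated polynomial is below \<open>q\<close>, the new colour determines the
  chosen point and the value there. Equal colours would mean that the two graphs meet in the point
  chosen for \<open>a\<close>, which was chosen to avoid the graph of \<open>b\<close>.\<close>

lemma linial_colour_neq:
  assumes "prime q"
    and "finite S" "card S * d < q" "a < q ^ Suc d" "\<And>b. b \<in> S \<Longrightarrow> b < q ^ Suc d" "a \<notin> S" "b \<in> S"
    and "finite S'" "card S' * d < q" "\<And>b. b \<in> S' \<Longrightarrow> b < q ^ Suc d" "b \<notin> S'"
  shows "linial_colour q d a S \<noteq> linial_colour q d b S'"
proof
  assume eq: "linial_colour q d a S = linial_colour q d b S'"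
  obtain x where x: "x < q" "\<And>b. b \<in> S \<Longrightarrow> digit_poly_eval q d a x \<noteq> digit_poly_eval q d b x"
    "linial_colour q d a S = x * q + digit_poly_eval q d a x"
    using linial_colour_correct[of q S d a] assms by metis
  obtain y where y: "y < q" "linial_colour q d b S' = y * q + digit_poly_eval q d b y"
    using linial_colour_correct[of q S' d b] assms by metis
  have q: "q > 0" using x by simp
  have "(x * q + digit_poly_eval q d a x) div q = x" "(y * q + digit_poly_eval q d b y) div q = y"
    using q digit_poly_eval_less by auto
  then have "x = y" using eq x y by metis
  then have "digit_poly_eval q d a x = digit_poly_eval q d b x" using eq x y by simp
  then show False using x(2) assms(7) by blast
qed

section \<open>Wake-up times\<close>

text \<open>In the inorder numbering of a complete binary tree the leaf \<open>s\<close> has the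
  number \<open>2 * s\<close>. The ancestor at height \<open>i\<close> is the node of index
  \<open>s div 2 ^ i\<close> on its level, and its number lies between those of its left and its
  right subtree.\<close>

definition ancestor_time :: "nat \<Rightarrow> nat \<Rightarrow> nat" where
  "ancestor_time s i = (s div 2 ^ i) * 2 ^ Suc i + 2 ^ i - 1"

text \<open>One level above the root of a tree with \<open>2 ^ k\<close> leaves is included. For
  \<open>s < 2 ^ k\<close> that last time is \<open>2 ^ Suc k - 1\<close>, common to all nodes and
  later than every slot, so that a node also learns of neighbours that joined after its own
  slot.\<close>

definition wake_times :: "nat \<Rightarrow> nat \<Rightarrow> nat set" where
  "wake_times k s = ancestor_time s ` {..Suc k}"

lemma ancestor_time_0: "ancestor_time s 0 = 2 * s"
  by (simp add: ancestor_time_def)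

lemma even_ancestor_time_iff: "even (ancestor_time s i) \<longleftrightarrow> i = 0"
proof (cases i)
  case (Suc j)
  have "even ((s div 2 ^ i) * 2 ^ Suc i + 2 ^ i)" "(2::nat) ^ i > 0" using Suc by auto
  then have "odd ((s div 2 ^ i) * 2 ^ Suc i + 2 ^ i - 1)" by (subst even_diff_nat) auto
  then show ?thesis using Suc by (simp add: ancestor_time_def)
qed (simp add: ancestor_time_0)

lemma double_mem_wake_times: "2 * s \<in> wake_times k s"
  unfolding wake_times_def by (metis ancestor_time_0 atMost_iff image_eqI zero_le)

lemma even_mem_wake_times_iff: "even t \<Longrightarrow> t \<in> wake_times k s \<longleftrightarrow> t = 2 * s"
  using double_mem_wake_times even_ancestor_time_iff unfolding wake_times_def
  by (auto simp: ancestor_time_0 double_mem_wake_times)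

lemma finite_wake_times [simp]: "finite (wake_times k s)"
  by (simp add: wake_times_def)

lemma card_wake_times_le: "card (wake_times k s) \<le> k + 2"
  unfolding wake_times_def using card_image_le[of "{..Suc k}" "ancestor_time s"] by simp

lemma root_mem_wake_times:
  assumes "s < 2 ^ k"
  shows "2 ^ Suc k - 1 \<in> wake_times k s"
proof -
  have "s < 2 ^ Suc k" using assms by simp
  then have "ancestor_time s (Suc k) = 2 ^ Suc k - 1" unfolding ancestor_time_def by simp
  then show ?thesis unfolding wake_times_def by (metis atMost_iff image_eqI order_refl)
qed

lemma wake_times_less:
  assumes "s < 2 ^ k" "t \<in> wake_times k s"
  shows "t < 2 ^ Suc k"
proof -
  obtain i where i: "i \<le> Suc k" "t = ancestor_time s i" using assms by (auto simp: wake_times_def)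
  show ?thesis
  proof (cases "i = Suc k")
    case True
    then show ?thesis using i assms by (simp add: ancestor_time_def)
  next
    case False
    then have ik: "i \<le> k" using i by simp
    have p: "(2::nat) ^ k = 2 ^ (k - i) * 2 ^ i" using ik by (simp add: power_add[symmetric])
    then have "s div 2 ^ i < 2 ^ (k - i)" using assms(1) by (simp add: less_mult_imp_div_less)
    then have "(s div 2 ^ i + 1) * 2 ^ i \<le> 2 ^ (k - i) * 2 ^ i" by (intro mult_le_mono1) simp
    then have "(s div 2 ^ i) * 2 ^ i + 2 ^ i \<le> 2 ^ k" using p by simp
    then have "2 * ((s div 2 ^ i) * 2 ^ i) + 2 * 2 ^ i \<le> 2 * 2 ^ k" by simp
    moreover have "(2::nat) ^ i > 0" by simp
    moreover have "t = 2 * ((s div 2 ^ i) * 2 ^ i) + 2 ^ i - 1" using i by (simp add: ancestor_time_def)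
    ultimately show ?thesis unfolding power_Suc by linarith
  qed
qed

text \<open>The common time is the inorder number of the lowest common ancestor of the leaves \<open>s\<close> and \<open>s'\<close>.\<close>
lemma common_wake_time:
  assumes "s < s'" "s' < 2 ^ k"
  obtains t where "t \<in> wake_times k s" "t \<in> wake_times k s'" "2 * s < t" "t < 2 * s'" "odd t"
proof -
  define i where "i = (LEAST i. s div 2 ^ i = s' div 2 ^ i)"
  have "s div 2 ^ k = s' div 2 ^ k" using assms by simp
  then have i: "s div 2 ^ i = s' div 2 ^ i" "i \<le> k"
    unfolding i_def by (rule LeastI, rule Least_le)
  have "i \<noteq> 0" using i assms by (intro notI) simp
  then obtain j where j: "i = Suc j" by (cases i) auto
  have ne: "s div 2 ^ j \<noteq> s' div 2 ^ j"
    using not_less_Least[of j "\<lambda>i. s div 2 ^ i = s' div 2 ^ i"] j unfolding i_def by simp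
  \<comment> \<open>Just below the lowest common ancestor the two paths pass through siblings:
    \<open>a\<close> is the left child, hence even, and \<open>b\<close> is its successor.\<close>
  define a b where "a = s div 2 ^ j" and "b = s' div 2 ^ j"
  have "a \<le> b" unfolding a_def b_def using assms by (intro div_le_mono) simp
  then have "a < b" using ne unfolding a_def b_def by simp
  have ab: "a div 2 = b div 2"
    using i(1) j unfolding a_def b_def by (simp add: div_mult2_eq mult.commute[of 2])
  have "a = 2 * (a div 2) + a mod 2" "b = 2 * (b div 2) + b mod 2" by simp_all
  moreover have "a mod 2 < 2" "b mod 2 < 2" by auto
  ultimately have ba: "b = 2 * (a div 2) + 1" "a = 2 * (a div 2)" using \<open>a < b\<close> ab by linarith+
  define c where "c = a div 2"
  have c: "b = 2 * c + 1" "a = 2 * c" using ba c_def by auto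
  have ci: "s div 2 ^ i = c" using j unfolding c_def a_def by (simp add: div_mult2_eq mult.commute[of 2])
  define t where "t = ancestor_time s i"
  have t: "t = (2 * c) * (2 * 2 ^ j) + 2 * 2 ^ j - 1"
    unfolding t_def ancestor_time_def ci by (simp add: j)
  have pj: "(2::nat) ^ j > 0" by simp
  have "s < (a + 1) * 2 ^ j" unfolding a_def using dividend_less_div_times[of "2 ^ j" s] by (simp add: mult.commute)
  then have s1: "s < 2 * c * 2 ^ j + 2 ^ j" unfolding c by simp
  have "b * 2 ^ j \<le> s'" unfolding b_def by simp
  then have s2: "2 * c * 2 ^ j + 2 ^ j \<le> s'" unfolding c by simp
  have t2: "t = 2 * (2 * c * 2 ^ j + 2 ^ j) - 1" unfolding t by (simp add: algebra_simps)
  \<comment> \<open>The first leaf of the right subtree; the ancestor's number is one less than that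
    of this leaf.\<close>
  define m where "m = 2 * c * 2 ^ j + 2 ^ j"
  have m: "s < m" "m \<le> s'" "t = 2 * m - 1" "m > 0"
    using s1 s2 t2 pj unfolding m_def by auto
  show ?thesis
  proof
    show "t \<in> wake_times k s" using i by (auto simp: t_def wake_times_def)
    have "t = ancestor_time s' i" unfolding t_def ancestor_time_def i(1) ..
    then show "t \<in> wake_times k s'" using i by (auto simp: wake_times_def)
    show "2 * s < t" using m by linarith
    show "t < 2 * s'" using m by linarith
    show "odd t" using even_ancestor_time_iff[of s i] \<open>i \<noteq> 0\<close> t_def by simp
  qed
qed

section \<open>The algorithm\<close>

definition undominated :: "nat set \<Rightarrow> (nat \<Rightarrow> nat \<Rightarrow> bool) \<Rightarrow> nat set \<Rightarrow> nat \<Rightarrow> bool" where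
  "undominated V E J v \<longleftrightarrow> v \<in> V \<and> v \<notin> J \<and> (\<forall>u. E v u \<longrightarrow> u \<notin> J)"

primrec slot_greedy :: "nat set \<Rightarrow> (nat \<Rightarrow> nat \<Rightarrow> bool) \<Rightarrow> (nat \<Rightarrow> nat) \<Rightarrow> nat set \<Rightarrow> nat \<Rightarrow> nat set" where
  "slot_greedy V E s J0 0 = J0"
| "slot_greedy V E s J0 (Suc r) = slot_greedy V E s J0 r \<union>
     {v. s v = r \<and> undominated V E (slot_greedy V E s J0 r) v \<and>
        (\<forall>u. E v u \<and> s u = r \<longrightarrow> \<not> undominated V E (slot_greedy V E s J0 r) u)}"

lemma slot_greedy_mono: "r \<le> r' \<Longrightarrow> slot_greedy V E s J0 r \<subseteq> slot_greedy V E s J0 r'"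
  by (induction r' rule: dec_induct) auto

lemma slot_greedy_slot: "v \<in> slot_greedy V E s J0 r \<Longrightarrow> v \<in> J0 \<or> s v < r"
  by (induction r) auto

lemma slot_greedy_slot_less:
  "v \<in> slot_greedy V E s J0 r' \<Longrightarrow> s v < r \<Longrightarrow> v \<in> slot_greedy V E s J0 r"
proof (induction r')
  case 0
  then show ?case using slot_greedy_mono[of 0 r V E s J0] by auto
next
  case (Suc r')
  then consider "v \<in> slot_greedy V E s J0 r'" | "v \<in> slot_greedy V E s J0 (Suc (s v))" by auto
  then show ?case
  proof cases
    case 2
    then show ?thesis using slot_greedy_mono[of "Suc (s v)" r V E s J0] Suc.prems by auto
  qed (use Suc in auto)
qed

lemma undominated_antimono: "J \<subseteq> J' \<Longrightarrow> undominated V E J' v \<Longrightarrow> undominated V E J v"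
  by (auto simp: undominated_def)

lemma independent_slot_greedy:
  assumes "simple_graph V E" "independent_set V E J0"
  shows "independent_set V E (slot_greedy V E s J0 r)"
proof (induction r)
  case (Suc r)
  show ?case unfolding independent_set_def
  proof (intro conjI ballI)
    show "slot_greedy V E s J0 (Suc r) \<subseteq> V"
      using Suc by (auto simp: undominated_def independent_set_def)
  next
    let ?J = "slot_greedy V E s J0 r"
    fix u v assume uv: "u \<in> slot_greedy V E s J0 (Suc r)" "v \<in> slot_greedy V E s J0 (Suc r)"
    show "\<not> E u v"
    proof
      assume e: "E u v"
      then have e': "E v u" using assms(1) by (auto simp: simple_graph_def)
      have cases: "w \<in> ?J \<or> s w = r \<and> undominated V E ?J w \<and> (\<forall>u. E w u \<and> s u = r \<longrightarrow> \<not> undominated V E ?J u)"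
        if "w \<in> slot_greedy V E s J0 (Suc r)" for w using that by simp
      have dom: "x \<notin> ?J" if "undominated V E ?J w" "E w x" for w x using that by (auto simp: undominated_def)
      have "\<not> (u \<in> ?J \<and> v \<in> ?J)" using Suc e by (auto simp: independent_set_def)
      then show False using cases[OF uv(1)] cases[OF uv(2)] e e' dom by meson
    qed
  qed
qed (use assms in simp)

text \<open>A node undominated at the end was undominated in its own slot too, and with properly
  coloured slots no undominated neighbour competes there, so it would have joined. Properness is
  asked only between nodes that \<open>J0\<close> leaves undominated, since only these get
  coloured.\<close>

lemma slot_greedy_proper_maximal:
  assumes sg: "simple_graph V E" and ind: "independent_set V E J0"
    and proper: "\<And>u v. undominated V E J0 u \<Longrightarrow> undominated V E J0 v \<Longrightarrow> E u v \<Longrightarrow> s u \<noteq> s v"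
    and bound: "\<And>v. v \<in> V \<Longrightarrow> s v < K"
  shows "maximal_independent_set V E (slot_greedy V E s J0 K)"
  unfolding maximal_independent_set_def
proof (intro conjI ballI)
  show "independent_set V E (slot_greedy V E s J0 K)" by (rule independent_slot_greedy) fact+
  fix v assume v: "v \<in> V - slot_greedy V E s J0 K"
  show "\<exists>u\<in>slot_greedy V E s J0 K. E u v"
  proof (rule ccontr)
    assume "\<not> ?thesis"
    then have und: "undominated V E (slot_greedy V E s J0 K) v"
      using v sg by (auto simp: undominated_def simple_graph_def)
    let ?J = "slot_greedy V E s J0 (s v)"
    have sub: "?J \<subseteq> slot_greedy V E s J0 K" "J0 \<subseteq> ?J" "slot_greedy V E s J0 (Suc (s v)) \<subseteq> slot_greedy V E s J0 K"
      using bound[of v] v slot_greedy_mono[of "s v" K V E s J0] slot_greedy_mono[of 0 "s v" V E s J0]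
        slot_greedy_mono[of "Suc (s v)" K V E s J0] by (auto simp del: slot_greedy.simps(2))
    have uv: "undominated V E ?J v" "undominated V E J0 v"
      using undominated_antimono[OF sub(1) und] undominated_antimono[OF sub(2)] by auto
    have "\<not> undominated V E ?J u" if "E v u" "s u = s v" for u
      using proper[of v u] uv that undominated_antimono[OF sub(2)] by metis
    then have "v \<in> slot_greedy V E s J0 (Suc (s v))" using uv by simp
    then show False using sub v by blast
  qed
qed

section \<open>Messages, states and transitions\<close>

definition encode_nat :: "nat \<Rightarrow> nat \<Rightarrow> msg" where
  "encode_nat l c = map (bit c) [0..<l]"

definition decode_nat :: "msg \<Rightarrow> nat" where
  "decode_nat = horner_sum of_bool 2"

lemma decode_encode_nat: "c < 2 ^ l \<Longrightarrow> decode_nat (encode_nat l c) = c"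
  by (simp add: decode_nat_def encode_nat_def horner_sum_bit_eq_take_bit take_bit_nat_eq_self)

definition wake_list :: "nat \<Rightarrow> nat \<Rightarrow> nat list" where
  "wake_list k s = sorted_list_of_set (wake_times k s)"

text \<open>A state is \<open>i # x # c # ts\<close>: the identifier, the status (0 undecided, 1 joined, 2 dominated),
  a colour, and the remaining wake-up times. The two slot processes occupy the rounds below
  \<open>2 ^ Suc k\<close> and from \<open>2 ^ Suc k + 2\<close> on; in both, decisions are made in even rounds and
  neighbours are informed in odd rounds. In the two rounds between them the undecided nodes
  compute their colours.\<close>
definition mis_send :: "nat \<Rightarrow> nat \<Rightarrow> lstate \<Rightarrow> nat \<Rightarrow> msg option" where
  "mis_send k l st u = (case st of i # x # c # t # ts \<Rightarrow>
     if x = (if even t \<or> t = 2 ^ Suc k + 1 then 0 else 1) then Some (encode_nat l c) else None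
   | _ \<Rightarrow> None)"

text \<open>The first colour reduction starts from the identifiers, which the inbox reveals as
  senders, so there the mere presence of a message counts. The reduction \<open>mod 2 ^ k\<close>
  keeps the second slot in range even if the colour is junk; this is why time and energy bounds
  never depend on luck. Decided nodes get the arbitrary slot 0 and stay available as
  informants.\<close>

definition mis_trans :: "nat \<Rightarrow> nat \<Rightarrow> nat \<Rightarrow> nat \<Rightarrow> nat \<Rightarrow> lstate \<Rightarrow> (nat \<Rightarrow> msg option) \<Rightarrow> lstate" where
  "mis_trans k l q1 q2 r st ib = (case st of i # x # c # t # ts \<Rightarrow>
     if r = 2 ^ Suc k then i # x # linial_colour q1 l i {u. ib u \<noteq> None} # ts
     else if r = 2 ^ Suc k + 1 then i # x # c # map ((+) (2 ^ Suc k + 2)) (wake_list k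
       (if x = 0 then linial_colour q2 3 c (decode_nat ` {m. \<exists>u. ib u = Some m}) mod 2 ^ k else 0))
     else if even r then i # (if x = 0 \<and> (\<forall>u. ib u = None) then 1 else x) # c # ts
     else i # (if x = 0 \<and> \<not> (\<forall>u. ib u = None) then 2 else x) # c # ts
   | _ \<Rightarrow> st)"

definition mis_init :: "nat \<Rightarrow> nat \<Rightarrow> nat \<Rightarrow> lstate" where
  "mis_init k i s = i # 0 # 0 # wake_list k s @ [2 ^ Suc k, 2 ^ Suc k + 1]"

text \<open>The slot is the only random choice, and every transition is a point mass. Its
  distribution \<open>P\<close> stays abstract, so that the run can be analysed for fixed slots
  without any probability.\<close>

definition mis_alg :: "nat \<Rightarrow> nat \<Rightarrow> nat \<Rightarrow> nat \<Rightarrow> nat pmf \<Rightarrow> algorithm" where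
  "mis_alg k l q1 q2 P = \<lparr>a_init = (\<lambda>i _. map_pmf (mis_init k i) P),
     a_wake = (\<lambda>st. case drop 3 st of [] \<Rightarrow> None | t # _ \<Rightarrow> Some t),
     a_send = mis_send k l,
     a_trans = (\<lambda>r st ib. return_pmf (mis_trans k l q1 q2 r st ib)),
     a_out = (\<lambda>st. st ! 1 = 1)\<rparr>"

section \<open>Executions with deterministic transitions\<close>

definition det_step :: "algorithm \<Rightarrow> (nat \<Rightarrow> lstate \<Rightarrow> (nat \<Rightarrow> msg option) \<Rightarrow> lstate) \<Rightarrow> nat set \<Rightarrow>
    (nat \<Rightarrow> nat \<Rightarrow> bool) \<Rightarrow> nat \<Rightarrow> config \<Rightarrow> config" where
  "det_step A \<delta> V E r c = (\<lambda>v. if v \<in> V then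
     (if awake_in A r (fst (c v)) then (\<delta> r (fst (c v)) (inbox A V E r c v), Suc (snd (c v))) else c v)
     else undefined)"

primrec det_run :: "algorithm \<Rightarrow> (nat \<Rightarrow> lstate \<Rightarrow> (nat \<Rightarrow> msg option) \<Rightarrow> lstate) \<Rightarrow> nat set \<Rightarrow>
    (nat \<Rightarrow> nat \<Rightarrow> bool) \<Rightarrow> config \<Rightarrow> nat \<Rightarrow> config" where
  "det_run A \<delta> V E c 0 = c"
| "det_run A \<delta> V E c (Suc r) = det_step A \<delta> V E r (det_run A \<delta> V E c r)"

text \<open>A product of point masses is a point mass, so the randomness stays confined to the
  initial configuration and each later configuration is a function of it.\<close>

lemma exec_det:
  assumes "finite V" "a_trans A = (\<lambda>r st ib. return_pmf (\<delta> r st ib))"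
  shows "exec A V E r = map_pmf (\<lambda>c. det_run A \<delta> V E c r) (exec A V E 0)"
proof (induction r)
  case 0
  show ?case by (simp add: map_pmf_ident[unfolded id_def])
next
  case (Suc r)
  have "round_step A V E r c = return_pmf (det_step A \<delta> V E r c)" for c
  proof -
    have "round_step A V E r c = Pi_pmf V undefined (\<lambda>v. return_pmf (det_step A \<delta> V E r c v))"
      unfolding round_step_def using assms
      by (intro Pi_pmf_cong) (auto simp: det_step_def)
    also have "\<dots> = return_pmf (det_step A \<delta> V E r c)"
      using assms(1) by (simp add: Pi_pmf_return_pmf) (auto simp: det_step_def fun_eq_iff)
    finally show ?thesis .
  qed
  then have "round_step A V E r = (\<lambda>c. return_pmf (det_step A \<delta> V E r c))" by (rule ext)
  then have "exec A V E (Suc r) = map_pmf (det_step A \<delta> V E r) (exec A V E r)"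
    by (simp only: exec.simps map_pmf_def)
  also have "\<dots> = map_pmf (\<lambda>c. det_run A \<delta> V E c (Suc r)) (exec A V E 0)"
    by (simp only: Suc pmf.map_comp o_def det_run.simps)
  finally show ?case .
qed

lemma sorted_list_of_set_ge:
  fixes S :: "nat set"
  assumes "finite S" "t \<in> S"
  shows "sorted_list_of_set {x \<in> S. t \<le> x} = t # sorted_list_of_set {x \<in> S. Suc t \<le> x}"
proof -
  have "sorted_wrt (<) (t # sorted_list_of_set {x \<in> S. Suc t \<le> x})"
    using assms(1) by (auto simp: strict_sorted_list_of_set)
  moreover have "set (t # sorted_list_of_set {x \<in> S. Suc t \<le> x}) = {x \<in> S. t \<le> x}"
    using assms by auto
  ultimately show ?thesis
    using assms(1) by (intro strict_sorted_equal) (auto simp: strict_sorted_list_of_set)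
qed

section \<open>The distributed run computes the two slot processes\<close>

definition status_of :: "nat set \<Rightarrow> (nat \<Rightarrow> nat \<Rightarrow> bool) \<Rightarrow> nat set \<Rightarrow> nat \<Rightarrow> nat" where
  "status_of V E J v = (if v \<in> J then 1 else if undominated V E J v then 0 else 2)"

definition residual_nbrs :: "nat set \<Rightarrow> (nat \<Rightarrow> nat \<Rightarrow> bool) \<Rightarrow> nat set \<Rightarrow> nat \<Rightarrow> nat set" where
  "residual_nbrs V E J v = {u. E v u \<and> undominated V E J u}"

definition colour1 :: "nat set \<Rightarrow> (nat \<Rightarrow> nat \<Rightarrow> bool) \<Rightarrow> nat \<Rightarrow> nat \<Rightarrow> nat set \<Rightarrow> nat \<Rightarrow> nat" where
  "colour1 V E l q1 J v = linial_colour q1 l v (residual_nbrs V E J v)"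

text \<open>This is the colour as the nodes compute it, including the loss of bits beyond
  \<open>l\<close> and the final remainder. The simulation is thereby exact for all parameters; for
  good ones both operations turn out to be identities.\<close>

definition colour2 :: "nat set \<Rightarrow> (nat \<Rightarrow> nat \<Rightarrow> bool) \<Rightarrow> nat \<Rightarrow> nat \<Rightarrow> nat \<Rightarrow> nat \<Rightarrow> nat set \<Rightarrow> nat \<Rightarrow> nat" where
  "colour2 V E k l q1 q2 J v = (if undominated V E J v then linial_colour q2 3 (colour1 V E l q1 J v)
     ((\<lambda>u. decode_nat (encode_nat l (colour1 V E l q1 J u))) ` residual_nbrs V E J v) mod 2 ^ k else 0)"

definition mis_result :: "nat set \<Rightarrow> (nat \<Rightarrow> nat \<Rightarrow> bool) \<Rightarrow> nat \<Rightarrow> nat \<Rightarrow> nat \<Rightarrow> nat \<Rightarrow> (nat \<Rightarrow> nat) \<Rightarrow> nat set" where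
  "mis_result V E k l q1 q2 s = (let J = slot_greedy V E s {} (2 ^ k)
     in slot_greedy V E (colour2 V E k l q1 q2 J) J (2 ^ k))"

context
  fixes V :: "nat set" and E :: "nat \<Rightarrow> nat \<Rightarrow> bool" and k l q1 q2 :: nat and P :: "nat pmf"
  assumes sg: "simple_graph V E"
begin

private abbreviation "A \<equiv> mis_alg k l q1 q2 P"
private abbreviation "step \<equiv> det_step A (mis_trans k l q1 q2) V E"

text \<open>A node's status may lag behind: it can be dominated without having heard of it. So
  status 1 is exact and status 2 is sound, but status 0 is excluded only once a joined neighbour has
  shared an odd wake-up time after its slot. After \<open>t\<close> rounds the slots
  \<open>r\<close> with \<open>2 * r < t\<close> are decided, which explains
  \<open>(t + 1) div 2\<close>. The offset \<open>t0\<close>, the initial set \<open>J0\<close> and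
  the later wake-up times \<open>rest\<close> are parameters so that both phases are
  instances.\<close>

lemma slot_phase_invariant:
  fixes c :: "nat \<Rightarrow> config" and t0 :: nat
  assumes ind: "independent_set V E J0"
    and s: "\<And>v. v \<in> V \<Longrightarrow> s v < 2 ^ k"
    and t0: "even t0" "t0 + 2 ^ Suc k \<le> 2 ^ Suc k \<or> 2 ^ Suc k + 2 \<le> t0"
    and run: "\<And>t. c (Suc t) = step t (c t)"
    and rest: "\<And>t. t \<in> set rest \<Longrightarrow> t0 + 2 ^ Suc k \<le> t"
    and init: "\<And>v. v \<in> V \<Longrightarrow>
      fst (c t0 v) = v # status_of V E J0 v # col v # map ((+) t0) (wake_list k (s v)) @ rest"
    and t: "t \<le> 2 ^ Suc k"
  defines "J r \<equiv> slot_greedy V E s J0 r"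
  shows "\<exists>x. \<forall>v\<in>V.
    fst (c (t0 + t) v) = v # x v # col v #
      map ((+) t0) (sorted_list_of_set {a \<in> wake_times k (s v). t \<le> a}) @ rest \<and>
    snd (c (t0 + t) v) = snd (c t0 v) + card {a \<in> wake_times k (s v). a < t} \<and>
    x v \<le> 2 \<and> (x v = 1 \<longleftrightarrow> v \<in> J ((t + 1) div 2)) \<and>
    (x v = 2 \<longrightarrow> (\<exists>u. E v u \<and> u \<in> J ((t + 1) div 2))) \<and>
    (\<forall>u. E v u \<and> u \<in> J ((t + 1) div 2) \<and>
      (u \<in> J0 \<or> (\<exists>a \<in> wake_times k (s u) \<inter> wake_times k (s v). odd a \<and> 2 * s u < a \<and> a < t)) \<longrightarrow> x v \<noteq> 0)"
  using t
proof (induction t)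
  case 0
  show ?case
    by (rule exI[of _ "status_of V E J0"])
      (auto simp: init wake_list_def status_of_def undominated_def J_def)
next
  case (Suc t)
  have E_sym: "E u v \<Longrightarrow> E v u" and E_V: "E u v \<Longrightarrow> u \<in> V" "E u v \<Longrightarrow> v \<in> V" for u v
    using sg by (auto simp: simple_graph_def)
  have J_V: "J r \<subseteq> V" for r
    using independent_slot_greedy[OF sg ind] unfolding J_def independent_set_def by blast
  have J_ind: "u \<in> J r \<Longrightarrow> v \<in> J r \<Longrightarrow> \<not> E u v" for u v r
    using independent_slot_greedy[OF sg ind] unfolding J_def independent_set_def by blast
  define W where "W v = wake_times k (s v)" for v
  let ?ts = "\<lambda>t v. map ((+) t0) (sorted_list_of_set {a \<in> W v. t \<le> a}) @ rest"
  have tlt: "t < 2 ^ Suc k" using Suc.prems by simp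
  obtain x where x: "\<And>v. v \<in> V \<Longrightarrow> fst (c (t0 + t) v) = v # x v # col v # ?ts t v"
    "\<And>v. v \<in> V \<Longrightarrow> snd (c (t0 + t) v) = snd (c t0 v) + card {a \<in> W v. a < t}"
    "\<And>v. v \<in> V \<Longrightarrow> x v \<le> 2"
    "\<And>v. v \<in> V \<Longrightarrow> x v = 1 \<longleftrightarrow> v \<in> J ((t + 1) div 2)"
    "\<And>v. v \<in> V \<Longrightarrow> x v = 2 \<Longrightarrow> \<exists>u. E v u \<and> u \<in> J ((t + 1) div 2)"
    "\<And>v u. v \<in> V \<Longrightarrow> E v u \<Longrightarrow> u \<in> J ((t + 1) div 2) \<Longrightarrow>
      u \<in> J0 \<or> (\<exists>a \<in> W u \<inter> W v. odd a \<and> 2 * s u < a \<and> a < t) \<Longrightarrow> x v \<noteq> 0"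
    using Suc unfolding W_def by (auto simp del: One_nat_def)
  have ts_in: "?ts t v = (t0 + t) # ?ts (Suc t) v" if "t \<in> W v" for v
    using sorted_list_of_set_ge[of "W v" t] that by (simp add: W_def)
  have ts_out: "?ts t v = ?ts (Suc t) v" if "t \<notin> W v" for v
  proof -
    have "{a \<in> W v. t \<le> a} = {a \<in> W v. Suc t \<le> a}" using that by (auto simp: Suc_le_eq le_less)
    then show ?thesis by simp
  qed
  have awake: "awake_in A (t0 + t) (fst (c (t0 + t) v)) \<longleftrightarrow> t \<in> W v" if "v \<in> V" for v
  proof (cases "t \<in> W v")
    case True
    then show ?thesis using x(1)[OF that] ts_in[OF True]
      by (simp add: awake_in_def mis_alg_def)
  next
    case False
    have "y > t0 + t" if y: "y \<in> set (?ts (Suc t) v)" for y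
      using y rest tlt by (fastforce simp: W_def)
    then have "?ts (Suc t) v = [] \<or> (\<exists>y ys. ?ts (Suc t) v = y # ys \<and> y > t0 + t)"
      by (metis list.set_intros(1) list.exhaust)
    then show ?thesis using x(1)[OF that] ts_out[OF False] False
      by (auto simp: awake_in_def mis_alg_def)
  qed
  have t_special: "t0 + t \<noteq> 2 ^ Suc k" "t0 + t \<noteq> 2 ^ Suc k + 1"
    using t0(2) tlt by auto
  have par: "even (t0 + t) \<longleftrightarrow> even t" using t0(1) by simp
  define ib where "ib v = inbox A V E (t0 + t) (c (t0 + t)) v" for v
  have got: "(\<exists>u. ib v u \<noteq> None) \<longleftrightarrow> (\<exists>u. E v u \<and> t \<in> W u \<and> x u = (if even t then 0 else 1))"
    if v: "v \<in> V" "t \<in> W v" for v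
  proof -
    have "ib v u \<noteq> None \<longleftrightarrow> E v u \<and> t \<in> W u \<and> x u = (if even t then 0 else 1)" for u
    proof (cases "E v u \<and> t \<in> W u")
      case True
      then have "u \<in> V" "E u v" using E_V E_sym by auto
      have "mis_send k l (fst (c (t0 + t) u)) v \<noteq> None \<longleftrightarrow> x u = (if even t then 0 else 1)"
        using x(1)[OF \<open>u \<in> V\<close>] ts_in[of u] True par t_special(2) by (simp add: mis_send_def)
      then show ?thesis using True \<open>u \<in> V\<close> \<open>E u v\<close> awake[OF \<open>u \<in> V\<close>] awake[OF v(1)] v(2)
        unfolding ib_def inbox_def by (simp add: mis_alg_def)
    next
      case False
      then show ?thesis using awake[of u] E_sym[of u v]
        unfolding ib_def inbox_def by auto
    qed
    then show ?thesis by simp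
  qed
  define x' where "x' v = (if t \<in> W v \<and> x v = 0 then
      (if even t then (if \<forall>u. ib v u = None then 1 else 0) else (if \<forall>u. ib v u = None then 0 else 2)) else x v)" for v
  have state': "fst (c (t0 + Suc t) v) = v # x' v # col v # ?ts (Suc t) v"
    "snd (c (t0 + Suc t) v) = snd (c t0 v) + card {a \<in> W v. a < Suc t}" if v: "v \<in> V" for v
  proof -
    have cS: "c (t0 + Suc t) v = (if t \<in> W v
        then (mis_trans k l q1 q2 (t0 + t) (fst (c (t0 + t) v)) (ib v), Suc (snd (c (t0 + t) v)))
        else c (t0 + t) v)"
      using run[of "t0 + t"] v awake[OF v] by (simp add: det_step_def ib_def)
    show "fst (c (t0 + Suc t) v) = v # x' v # col v # ?ts (Suc t) v"
    proof (cases "t \<in> W v")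
      case True
      then show ?thesis using cS x(1)[OF v] ts_in[OF True] t_special par
        by (simp add: mis_trans_def x'_def)
    next
      case False
      then show ?thesis using cS x(1)[OF v] ts_out[OF False] by (simp add: x'_def)
    qed
    show "snd (c (t0 + Suc t) v) = snd (c t0 v) + card {a \<in> W v. a < Suc t}"
    proof (cases "t \<in> W v")
      case True
      then have "{a \<in> W v. a < Suc t} = insert t {a \<in> W v. a < t}" by auto
      then show ?thesis using cS x(2)[OF v] True by (simp add: W_def)
    next
      case False
      then have "{a \<in> W v. a < Suc t} = {a \<in> W v. a < t}" by (auto simp: less_Suc_eq)
      then show ?thesis using cS x(2)[OF v] False by simp
    qed
  qed
  have "\<forall>v\<in>V. x' v \<le> 2 \<and> (x' v = 1 \<longleftrightarrow> v \<in> J ((Suc t + 1) div 2)) \<and>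
    (x' v = 2 \<longrightarrow> (\<exists>u. E v u \<and> u \<in> J ((Suc t + 1) div 2))) \<and>
    (\<forall>u. E v u \<and> u \<in> J ((Suc t + 1) div 2) \<and>
      (u \<in> J0 \<or> (\<exists>a \<in> W u \<inter> W v. odd a \<and> 2 * s u < a \<and> a < Suc t)) \<longrightarrow> x' v \<noteq> 0)"
  proof (cases "even t")
    case True
    then obtain r where r: "t = 2 * r" by (auto elim: evenE)
    have dv: "(t + 1) div 2 = r" "(Suc t + 1) div 2 = Suc r" using r by auto
    have inW: "t \<in> W v \<longleftrightarrow> s v = r" for v
      using even_mem_wake_times_iff[OF True] r by (auto simp: W_def)
    \<comment> \<open>In its own slot a node's status is accurate: a joined neighbour outside
      \<open>J0\<close> has a smaller slot, and the common wake-up time between the two slots is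
      already past.\<close>
    have x0: "x v = 0 \<longleftrightarrow> undominated V E (J r) v" if v: "v \<in> V" "s v = r" for v
    proof
      assume "x v = 0"
      have "v \<notin> J r" using x(4)[OF v(1)] \<open>x v = 0\<close> dv by simp
      moreover have "u \<notin> J r" if e: "E v u" for u
      proof
        assume u: "u \<in> J r"
        have "\<exists>a \<in> W u \<inter> W v. odd a \<and> 2 * s u < a \<and> a < t" if "u \<notin> J0"
        proof -
          have "s u < s v" using slot_greedy_slot[of u V E s J0 r] that u v by (auto simp: J_def)
          then show ?thesis using common_wake_time[of "s u" "s v" k] s[OF v(1)] r v(2)
            unfolding W_def by (metis IntI)
        qed
        then show False using x(6)[OF v(1) e] u dv \<open>x v = 0\<close> by auto
      qed
      ultimately show "undominated V E (J r) v" using v by (auto simp: undominated_def)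
    next
      assume und: "undominated V E (J r) v"
      then have "x v \<noteq> 1" "x v \<noteq> 2"
        using x(4,5)[OF v(1)] dv by (auto simp: undominated_def)
      then show "x v = 0" using x(3)[OF v(1)] by linarith
    qed
    have x'1: "x' v = 1 \<longleftrightarrow> v \<in> J (Suc r)" if v: "v \<in> V" for v
    proof (cases "s v = r \<and> undominated V E (J r) v")
      case c: True
      have "(\<forall>u. ib v u = None) \<longleftrightarrow> \<not> (\<exists>u. E v u \<and> t \<in> W u \<and> x u = 0)"
        using got[OF v] inW c True by auto
      also have "\<dots> \<longleftrightarrow> (\<forall>u. E v u \<and> s u = r \<longrightarrow> \<not> undominated V E (J r) u)"
        using x0 inW E_V by blast
      finally have "(\<forall>u. ib v u = None) \<longleftrightarrow> v \<in> J (Suc r)"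
        using c by (auto simp: J_def undominated_def)
      then show ?thesis using c x0[OF v] inW True by (simp add: x'_def)
    next
      case c: False
      then have "x' v = x v" using x0[OF v] inW by (auto simp: x'_def)
      moreover have "v \<in> J (Suc r) \<longleftrightarrow> v \<in> J r" using c by (auto simp: J_def)
      ultimately show ?thesis using x(4)[OF v] dv by simp
    qed
    have mono: "J r \<subseteq> J (Suc r)" unfolding J_def by (rule slot_greedy_mono) simp
    have keep: "x' v \<noteq> 0" if "x v \<noteq> 0" for v using that by (simp add: x'_def)
    have x'2: "x' v = 2 \<Longrightarrow> x v = 2" for v using True by (auto simp: x'_def split: if_splits)
    have x'3: "x' v \<noteq> 0" if v: "v \<in> V" "E v u" "u \<in> J (Suc r)"
      "u \<in> J0 \<or> (\<exists>a \<in> W u \<inter> W v. odd a \<and> 2 * s u < a \<and> a < Suc t)" for u v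
    proof -
      have 1: "u \<in> J0 \<or> (\<exists>a \<in> W u \<inter> W v. odd a \<and> 2 * s u < a \<and> a < t)"
        using v(4) True by (metis less_SucE)
      have "u \<in> J r"
      proof (cases "u \<in> J0")
        case True
        then show ?thesis using slot_greedy_mono[of 0 r V E s J0] by (auto simp: J_def)
      next
        case False
        then have "s u < r" using 1 r by auto
        then show ?thesis using v(3) slot_greedy_slot_less unfolding J_def by blast
      qed
      then show ?thesis using x(6)[OF v(1,2)] 1 dv keep by blast
    qed
    have "x' v \<le> 2" if "v \<in> V" for v using x(3)[OF that] by (simp add: x'_def)
    moreover have "\<exists>u. E v u \<and> u \<in> J (Suc r)" if "v \<in> V" "x' v = 2" for v
      using x(5)[OF that(1) x'2[OF that(2)]] mono dv by auto
    ultimately show ?thesis using x'1 x'3 unfolding dv by blast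
  next
    case False
    then obtain r where r: "t = 2 * r + 1" by (auto elim: oddE)
    have dv: "(t + 1) div 2 = Suc r" "(Suc t + 1) div 2 = Suc r" using r by auto
    have gt: "(\<forall>u. ib v u = None) \<longleftrightarrow> \<not> (\<exists>u. E v u \<and> t \<in> W u \<and> u \<in> J (Suc r))"
      if "v \<in> V" "t \<in> W v" for v
      using got[OF that] False x(4) dv E_V by auto
    have x'1: "x' v = 1 \<longleftrightarrow> v \<in> J (Suc r)" if v: "v \<in> V" for v
      using x(4)[OF v] dv False by (auto simp: x'_def)
    have x'2: "\<exists>u. E v u \<and> u \<in> J (Suc r)" if "v \<in> V" "x' v = 2" for v
      using that x(5)[of v] gt[of v] dv False by (auto simp: x'_def split: if_splits)
    have x'3: "x' v \<noteq> 0" if v: "v \<in> V" "E v u" "u \<in> J (Suc r)"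
      "u \<in> J0 \<or> (\<exists>a \<in> W u \<inter> W v. odd a \<and> 2 * s u < a \<and> a < Suc t)" for u v
    proof (cases "u \<in> J0 \<or> (\<exists>a \<in> W u \<inter> W v. odd a \<and> 2 * s u < a \<and> a < t)")
      case True
      then have "x v \<noteq> 0" using x(6)[OF v(1,2)] v(3) dv by simp
      then show ?thesis by (simp add: x'_def)
    next
      case c: False
      then have "t \<in> W u" "t \<in> W v" using v(4) by (auto simp: less_Suc_eq)
      then have "\<not> (\<forall>u. ib v u = None)" using gt v by blast
      then show ?thesis using False \<open>t \<in> W v\<close> by (auto simp: x'_def)
    qed
    have "x' v \<le> 2" if "v \<in> V" for v using x(3)[OF that] by (simp add: x'_def)
    then show ?thesis using x'1 x'2 x'3 unfolding dv by blast
  qed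
  then show ?case using state' unfolding W_def by (intro exI[of _ x']) blast
qed

text \<open>All nodes are awake at time \<open>2 ^ Suc k - 1\<close>, after the last decision.
  Whoever still lags hears of a joined neighbour then, so the status becomes exact.\<close>

lemma slot_phase_end:
  fixes c :: "nat \<Rightarrow> config" and t0 :: nat
  assumes ind: "independent_set V E J0"
    and s: "\<And>v. v \<in> V \<Longrightarrow> s v < 2 ^ k"
    and t0: "even t0" "t0 + 2 ^ Suc k \<le> 2 ^ Suc k \<or> 2 ^ Suc k + 2 \<le> t0"
    and run: "\<And>t. c (Suc t) = step t (c t)"
    and rest: "\<And>t. t \<in> set rest \<Longrightarrow> t0 + 2 ^ Suc k \<le> t"
    and init: "\<And>v. v \<in> V \<Longrightarrow>
      fst (c t0 v) = v # status_of V E J0 v # col v # map ((+) t0) (wake_list k (s v)) @ rest"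
    and v: "v \<in> V"
  shows "fst (c (t0 + 2 ^ Suc k) v) = v # status_of V E (slot_greedy V E s J0 (2 ^ k)) v # col v # rest"
    and "snd (c (t0 + 2 ^ Suc k) v) \<le> snd (c t0 v) + k + 2"
proof -
  let ?J = "slot_greedy V E s J0 (2 ^ k)" and ?M = "2 ^ Suc k :: nat"
  have half: "(?M + 1) div 2 = 2 ^ k" by simp
  obtain x where x: "\<And>v. v \<in> V \<Longrightarrow> fst (c (t0 + ?M) v) = v # x v # col v #
      map ((+) t0) (sorted_list_of_set {a \<in> wake_times k (s v). ?M \<le> a}) @ rest"
    "\<And>v. v \<in> V \<Longrightarrow> snd (c (t0 + ?M) v) = snd (c t0 v) + card {a \<in> wake_times k (s v). a < ?M}"
    "\<And>v. v \<in> V \<Longrightarrow> x v \<le> 2" "\<And>v. v \<in> V \<Longrightarrow> x v = 1 \<longleftrightarrow> v \<in> ?J"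
    "\<And>v. v \<in> V \<Longrightarrow> x v = 2 \<Longrightarrow> \<exists>u. E v u \<and> u \<in> ?J"
    "\<And>v u. v \<in> V \<Longrightarrow> E v u \<Longrightarrow> u \<in> ?J \<Longrightarrow>
       u \<in> J0 \<or> (\<exists>a \<in> wake_times k (s u) \<inter> wake_times k (s v). odd a \<and> 2 * s u < a \<and> a < ?M) \<Longrightarrow> x v \<noteq> 0"
    using slot_phase_invariant[OF ind s t0 run rest init order_refl] unfolding half by blast
  have "{a \<in> wake_times k (s v). ?M \<le> a} = {}" using wake_times_less[OF s[OF v]] by force
  moreover have "x v = status_of V E ?J v"
  proof -
    have "x v \<noteq> 0" if "E v u" "u \<in> ?J" for u
    proof -
      have "u \<in> V" using sg that by (auto simp: simple_graph_def)
      have "odd (?M - 1)" by simp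
      moreover have "2 * s u < ?M - 1" using s[OF \<open>u \<in> V\<close>] by (cases "(2::nat) ^ k") auto
      moreover have "?M - 1 < ?M" by simp
      ultimately have "\<exists>a \<in> wake_times k (s u) \<inter> wake_times k (s v). odd a \<and> 2 * s u < a \<and> a < ?M"
        using root_mem_wake_times[OF s[OF v]] root_mem_wake_times[OF s[OF \<open>u \<in> V\<close>]] by blast
      then show ?thesis using x(6)[OF v] that by blast
    qed
    moreover have "x v = 0 \<or> x v = 1 \<or> x v = 2" using x(3)[OF v] by linarith
    ultimately show ?thesis using x(4,5)[OF v] v
      by (auto simp: status_of_def undominated_def)
  qed
  ultimately show "fst (c (t0 + 2 ^ Suc k) v) = v # status_of V E ?J v # col v # rest"
    using x(1)[OF v] by simp
  have "card {a \<in> wake_times k (s v). a < ?M} \<le> card (wake_times k (s v))" by (intro card_mono) auto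
  then show "snd (c (t0 + 2 ^ Suc k) v) \<le> snd (c t0 v) + k + 2"
    using x(2)[OF v] card_wake_times_le[of k "s v"] by simp
qed

lemma colour_rounds:
  fixes c :: "nat \<Rightarrow> config"
  assumes run: "\<And>t. c (Suc t) = step t (c t)"
    and init: "\<And>v. v \<in> V \<Longrightarrow> fst (c (2 ^ Suc k) v) = v # status_of V E J v # 0 # [2 ^ Suc k, 2 ^ Suc k + 1]"
    and v: "v \<in> V"
  shows "fst (c (2 ^ Suc k + 2) v) =
      v # status_of V E J v # colour1 V E l q1 J v # map ((+) (2 ^ Suc k + 2)) (wake_list k (colour2 V E k l q1 q2 J v))"
    and "snd (c (2 ^ Suc k + 2) v) = snd (c (2 ^ Suc k) v) + 2"
proof -
  let ?M = "2 ^ Suc k :: nat"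
  have E_V: "u \<in> V" "E u v" if "E v u" for u v using sg that by (auto simp: simple_graph_def)
  have st0: "status_of V E J u = 0 \<longleftrightarrow> undominated V E J u" for u
    by (auto simp: status_of_def undominated_def)
  have aw: "awake_in A ?M (fst (c ?M v))" if "v \<in> V" for v
    using init[OF that] by (simp add: awake_in_def mis_alg_def)
  have ib: "inbox A V E ?M (c ?M) v u \<noteq> None \<longleftrightarrow> u \<in> residual_nbrs V E J v" if v: "v \<in> V" for u v
  proof (cases "E v u")
    case True
    then have "u \<in> V" "E u v" using E_V by auto
    then show ?thesis using aw[OF \<open>u \<in> V\<close>] aw[OF v] True init[OF \<open>u \<in> V\<close>] st0
      by (simp add: inbox_def residual_nbrs_def mis_alg_def mis_send_def)
  next
    case False
    then show ?thesis using E_V by (auto simp: inbox_def residual_nbrs_def)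
  qed
  have c1: "c (Suc ?M) v = (v # status_of V E J v # colour1 V E l q1 J v # [?M + 1], Suc (snd (c ?M v)))"
    if v: "v \<in> V" for v
    using run[of ?M] v aw[OF v] init[OF v] ib[OF v]
    by (simp add: det_step_def mis_trans_def colour1_def)
  have aw': "awake_in A (Suc ?M) (fst (c (Suc ?M) v))" if "v \<in> V" for v
    using c1[OF that] by (simp add: awake_in_def mis_alg_def)
  have ib': "inbox A V E (Suc ?M) (c (Suc ?M)) v u =
      (if u \<in> residual_nbrs V E J v then Some (encode_nat l (colour1 V E l q1 J u)) else None)" if v: "v \<in> V" for u v
  proof (cases "E v u")
    case True
    then have "u \<in> V" "E u v" using E_V by auto
    then show ?thesis using aw'[OF \<open>u \<in> V\<close>] aw'[OF v] True c1[OF \<open>u \<in> V\<close>] st0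
      by (simp add: inbox_def residual_nbrs_def mis_alg_def mis_send_def)
  next
    case False
    then show ?thesis using E_V by (auto simp: inbox_def residual_nbrs_def)
  qed
  have set_eq: "decode_nat ` {m. \<exists>u. inbox A V E (Suc ?M) (c (Suc ?M)) v u = Some m} =
      (\<lambda>u. decode_nat (encode_nat l (colour1 V E l q1 J u))) ` residual_nbrs V E J v"
    unfolding ib'[OF v] by (auto split: if_splits)
  have "c (Suc (Suc ?M)) v = (v # status_of V E J v # colour1 V E l q1 J v #
      map ((+) (?M + 2)) (wake_list k (colour2 V E k l q1 q2 J v)), Suc (Suc (snd (c ?M v))))"
    using run[of "Suc ?M"] v aw'[OF v] c1[OF v] st0 set_eq
    by (simp add: det_step_def mis_trans_def colour2_def)
  then show "fst (c (2 ^ Suc k + 2) v) =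
      v # status_of V E J v # colour1 V E l q1 J v # map ((+) (2 ^ Suc k + 2)) (wake_list k (colour2 V E k l q1 q2 J v))"
    and "snd (c (2 ^ Suc k + 2) v) = snd (c (2 ^ Suc k) v) + 2" by simp_all
qed

text \<open>Each slot phase costs at most \<open>k + 2\<close> wake-ups and colouring costs 2.
  Afterwards all wake lists are empty, which freezes the configuration and allows any later
  \<open>T\<close>.\<close>

lemma mis_run:
  fixes s :: "nat \<Rightarrow> nat"
  assumes s: "\<And>v. v \<in> V \<Longrightarrow> s v < 2 ^ k"
    and c0: "\<And>v. v \<in> V \<Longrightarrow> c0 v = (mis_init k v (s v), 0)"
    and T: "T \<ge> 2 * 2 ^ Suc k + 2"
  defines "c \<equiv> det_run A (mis_trans k l q1 q2) V E c0"
  shows "\<And>v. v \<in> V \<Longrightarrow> a_wake A (fst (c T v)) = None"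
    and "\<And>v. v \<in> V \<Longrightarrow> snd (c T v) \<le> 2 * k + 6"
    and "output_set A V (c T) = mis_result V E k l q1 q2 s"
proof -
  let ?M = "2 ^ Suc k :: nat"
  define J where "J = slot_greedy V E s {} (2 ^ k)"
  have run: "c (Suc t) = step t (c t)" for t by (simp add: c_def)
  have ind0: "independent_set V E {}" by (simp add: independent_set_def)
  have init0: "fst (c 0 v) = v # status_of V E {} v # 0 # map ((+) 0) (wake_list k (s v)) @ [?M, ?M + 1]"
    if "v \<in> V" for v
    using c0[OF that] that by (simp add: c_def mis_init_def status_of_def undominated_def map_idI)
  have rest0: "0 + ?M \<le> t" if "t \<in> set [?M, ?M + 1]" for t using that by auto
  have p1: "fst (c (0 + ?M) v) = v # status_of V E J v # 0 # [?M, ?M + 1]"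
    "snd (c (0 + ?M) v) \<le> snd (c 0 v) + k + 2" if "v \<in> V" for v
    unfolding J_def
    using slot_phase_end[OF ind0 s _ _ run rest0 init0 that] by auto
  have p1': "fst (c ?M v) = v # status_of V E J v # 0 # [?M, ?M + 1]" if "v \<in> V" for v
    using p1(1)[OF that] by simp
  have p2: "fst (c (?M + 2) v) =
      v # status_of V E J v # colour1 V E l q1 J v # map ((+) (?M + 2)) (wake_list k (colour2 V E k l q1 q2 J v)) @ []"
    "snd (c (?M + 2) v) = snd (c ?M v) + 2" if "v \<in> V" for v
    using colour_rounds[OF run p1' that] by simp_all
  have indJ: "independent_set V E J" unfolding J_def by (rule independent_slot_greedy[OF sg ind0])
  have s2: "colour2 V E k l q1 q2 J v < 2 ^ k" for v by (simp add: colour2_def)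
  have p3: "fst (c (?M + 2 + ?M) v) = v # status_of V E (mis_result V E k l q1 q2 s) v # colour1 V E l q1 J v # []"
    "snd (c (?M + 2 + ?M) v) \<le> snd (c (?M + 2) v) + k + 2" if "v \<in> V" for v
    unfolding mis_result_def Let_def J_def[symmetric]
    using slot_phase_end[OF indJ s2 _ _ run _ p2(1) that] by auto
  have T1: "?M + 2 + ?M \<le> T" using T by simp
  have stay: "c t v = c (?M + 2 + ?M) v" if v: "v \<in> V" and t: "?M + 2 + ?M \<le> t" for t v
    using t
  proof (induction t rule: dec_induct)
    case (step t)
    have "\<not> awake_in A t (fst (c t v))"
      using p3(1)[OF v] step.IH by (simp add: awake_in_def mis_alg_def)
    then show ?case using run[of t] v step.IH by (simp add: det_step_def)
  qed simp
  have fin: "c T v = c (?M + 2 + ?M) v" if v: "v \<in> V" for v using stay[OF v T1] .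
  show "a_wake A (fst (c T v)) = None" if "v \<in> V" for v
    using fin[OF that] p3(1)[OF that] by (simp add: mis_alg_def)
  show "snd (c T v) \<le> 2 * k + 6" if "v \<in> V" for v
  proof -
    have "snd (c 0 v) = 0" using c0[OF that] by (simp add: c_def)
    then show ?thesis using fin[OF that] p3(2)[OF that] p2(2)[OF that] p1(2)[OF that] by simp
  qed
  have "mis_result V E k l q1 q2 s \<subseteq> V"
    using independent_slot_greedy[OF sg indJ] unfolding mis_result_def Let_def J_def[symmetric]
    by (auto simp: independent_set_def)
  then show "output_set A V (c T) = mis_result V E k l q1 q2 s"
    using fin p3(1) by (auto simp: output_set_def mis_alg_def status_of_def split: if_splits)
qed

lemma independent_mis_result: "independent_set V E (mis_result V E k l q1 q2 s)"
  unfolding mis_result_def Let_def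
  by (intro independent_slot_greedy[OF sg]) (simp add: independent_set_def)

text \<open>The conditions chain the two reductions. Identifiers have \<open>l + 1\<close> digits in
  base \<open>q1\<close>; the resulting colours are below \<open>q1\<^sup>2\<close>, hence fit into
  \<open>l\<close> bits and into four digits in base \<open>q2\<close>; the final colours are below
  \<open>q2\<^sup>2\<close> and serve as slots. The degree bound \<open>D\<close> leaves a free
  point in both steps.\<close>

lemma maximal_mis_result:
  assumes q: "prime q1" "prime q2" "D * l < q1" "D * 3 < q2" "q1\<^sup>2 \<le> q2 ^ 4" "q1\<^sup>2 \<le> 2 ^ l" "q2\<^sup>2 \<le> 2 ^ k"
    and V: "V \<subseteq> {..<q1 ^ Suc l}"
  defines "J \<equiv> \<lambda>s. slot_greedy V E s {} (2 ^ k)"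
  assumes deg: "\<And>v. undominated V E (J s) v \<Longrightarrow> card (residual_nbrs V E (J s) v) \<le> D"
  shows "maximal_independent_set V E (mis_result V E k l q1 q2 s)"
proof -
  let ?U = "undominated V E (J s)" and ?N = "residual_nbrs V E (J s)"
  have U_V: "?U v \<Longrightarrow> v \<in> V" for v by (simp add: undominated_def)
  have finV: "finite V" using sg by (simp add: simple_graph_def)
  have finN: "finite (?N v)" for v
    by (rule finite_subset[OF _ finV]) (auto simp: residual_nbrs_def undominated_def)
  have ids: "v < q1 ^ Suc l" if "?U v" for v using U_V[OF that] V by auto
  have NU: "u \<in> ?N v \<Longrightarrow> ?U u" "u \<in> ?N v \<longleftrightarrow> ?U u \<and> E v u" "v \<notin> ?N v" for u v
    using sg by (auto simp: residual_nbrs_def simple_graph_def)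
  have cardN: "card (?N v) * l < q1" "card (?N v) * 3 < q2" if "?U v" for v
    using deg[OF that] q by (meson mult_le_mono1 order_le_less_trans)+
  have c1_less: "colour1 V E l q1 (J s) v < q1\<^sup>2" if "?U v" for v
    unfolding colour1_def
    using linial_colour_less[OF q(1) finN cardN(1)[OF that] ids[OF that] ids NU(3)] NU(1) by blast
  have c1_neq: "colour1 V E l q1 (J s) v \<noteq> colour1 V E l q1 (J s) u" if "?U v" "?U u" "E v u" for u v
    unfolding colour1_def
    using linial_colour_neq[OF q(1) finN cardN(1)[OF that(1)] ids[OF that(1)] ids NU(3) _ finN
        cardN(1)[OF that(2)] ids NU(3)] NU(1,2) that by blast
  have c2: "colour2 V E k l q1 q2 (J s) v = linial_colour q2 3 (colour1 V E l q1 (J s) v) (colour1 V E l q1 (J s) ` ?N v)" if v: "?U v" for v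
  proof -
    have dec: "(\<lambda>u. decode_nat (encode_nat l (colour1 V E l q1 (J s) u))) ` ?N v = colour1 V E l q1 (J s) ` ?N v"
      using c1_less NU(1) q(6) by (intro image_cong refl decode_encode_nat) (meson order_less_le_trans)
    have "linial_colour q2 3 (colour1 V E l q1 (J s) v) (colour1 V E l q1 (J s) ` ?N v) < q2\<^sup>2"
    proof (rule linial_colour_less[OF q(2)])
      show "card (colour1 V E l q1 (J s) ` ?N v) * 3 < q2"
        using cardN(2)[OF v] card_image_le[OF finN, of "colour1 V E l q1 (J s)"]
        by (meson mult_le_mono1 order_le_less_trans)
      show "colour1 V E l q1 (J s) v < q2 ^ Suc 3" "\<And>b. b \<in> colour1 V E l q1 (J s) ` ?N v \<Longrightarrow> b < q2 ^ Suc 3"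
        using c1_less[OF v] c1_less NU(1) q(5) by (fastforce intro: order_less_le_trans)+
      show "colour1 V E l q1 (J s) v \<notin> colour1 V E l q1 (J s) ` ?N v" using c1_neq[OF v] NU(2) by auto
    qed (use finN in simp)
    then show ?thesis using v q(7) unfolding colour2_def dec by simp
  qed
  have c2_neq: "colour2 V E k l q1 q2 (J s) u \<noteq> colour2 V E k l q1 q2 (J s) v" if "?U u" "?U v" "E u v" for u v
    unfolding c2[OF that(1)] c2[OF that(2)]
  proof (rule linial_colour_neq[OF q(2)])
    have lt: "colour1 V E l q1 (J s) w < q2 ^ Suc 3" if "?U w" for w
      using c1_less[OF that] q(5) by simp
    have "E v u" using sg that by (auto simp: simple_graph_def)
    show "card (colour1 V E l q1 (J s) ` ?N u) * 3 < q2" "card (colour1 V E l q1 (J s) ` ?N v) * 3 < q2"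
      using cardN(2) that card_image_le[OF finN, of "colour1 V E l q1 (J s)"]
      by (meson mult_le_mono1 order_le_less_trans)+
    show "colour1 V E l q1 (J s) u < q2 ^ Suc 3" using lt that by simp
    show "b < q2 ^ Suc 3" if "b \<in> colour1 V E l q1 (J s) ` ?N w" for b w using that lt NU(1) by auto
    show "b < q2 ^ Suc 3" if "b \<in> colour1 V E l q1 (J s) ` ?N w" for b w using that lt NU(1) by auto
    show "colour1 V E l q1 (J s) u \<notin> colour1 V E l q1 (J s) ` ?N u" "colour1 V E l q1 (J s) v \<notin> colour1 V E l q1 (J s) ` ?N v"
      using c1_neq that NU(2) by auto
    show "colour1 V E l q1 (J s) v \<in> colour1 V E l q1 (J s) ` ?N u" using that NU(2) by auto
  qed (use finN in auto)
  have "maximal_independent_set V E (slot_greedy V E (colour2 V E k l q1 q2 (J s)) (J s) (2 ^ k))"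
  proof (rule slot_greedy_proper_maximal[OF sg _ c2_neq])
    show "independent_set V E (J s)" unfolding J_def
      by (rule independent_slot_greedy[OF sg]) (simp add: independent_set_def)
    show "colour2 V E k l q1 q2 (J s) v < 2 ^ k" for v by (simp add: colour2_def)
  qed
  then show ?thesis by (simp add: mis_result_def Let_def J_def)
qed

end

section \<open>Random slots\<close>

lemma finite_set_Pi_pmf:
  assumes "finite A" "\<And>x. x \<in> A \<Longrightarrow> finite (set_pmf (p x))"
  shows "finite (set_pmf (Pi_pmf A d p))"
  using assms by (auto simp: set_Pi_pmf)

lemma Pi_pmf_map_dep:
  assumes "finite A"
  shows "Pi_pmf A d (\<lambda>x. map_pmf (g x) (p x)) =
    map_pmf (\<lambda>f x. if x \<in> A then g x (f x) else d) (Pi_pmf A d' p)"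
proof -
  have "Pi_pmf A d (\<lambda>x. bind_pmf (p x) (\<lambda>y. return_pmf (g x y))) =
      bind_pmf (Pi_pmf A d' p) (\<lambda>f. Pi_pmf A d (\<lambda>x. return_pmf (g x (f x))))"
    by (rule Pi_pmf_bind[OF assms])
  also have "\<dots> = bind_pmf (Pi_pmf A d' p) (\<lambda>f. return_pmf (\<lambda>x. if x \<in> A then g x (f x) else d))"
    using assms by simp
  finally show ?thesis by (simp only: map_pmf_def)
qed

lemma expectation_bind_le:
  fixes f :: "'a \<Rightarrow> real" and g :: "'b \<Rightarrow> real"
  assumes "finite (set_pmf p)" "\<And>x. x \<in> set_pmf p \<Longrightarrow> finite (set_pmf (q x))"
    and "\<And>x. x \<in> set_pmf p \<Longrightarrow> measure_pmf.expectation (q x) g \<le> f x"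
  shows "measure_pmf.expectation (bind_pmf p q) g \<le> measure_pmf.expectation p f"
proof -
  have "measure_pmf.expectation (bind_pmf p q) g =
      (\<Sum>a\<in>set_pmf p. pmf p a *\<^sub>R measure_pmf.expectation (q a) g)"
    using assms by (intro pmf_expectation_bind) auto
  also have "\<dots> \<le> (\<Sum>a\<in>set_pmf p. pmf p a *\<^sub>R f a)"
    using assms by (intro sum_mono scaleR_left_mono) auto
  also have "\<dots> = measure_pmf.expectation p f"
    using assms by (intro integral_measure_pmf[symmetric]) auto
  finally show ?thesis .
qed

text \<open>By independence the event for \<open>u\<close> has probability
  \<open>h * (1 - h) ^ card (B u)\<close>, at least \<open>h / 2\<close> by Bernoulli's inequality.
  As \<open>B u\<close> contains the rest of \<open>W\<close>, the events are disjoint and the union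
  loses nothing.\<close>

lemma prob_isolated_success_ge:
  fixes h :: real
  assumes fin: "finite V" and h: "0 \<le> h" "h \<le> 1" and W: "W \<subseteq> V"
    and B: "\<And>u. u \<in> W \<Longrightarrow> B u \<subseteq> V" "\<And>u. u \<in> W \<Longrightarrow> u \<notin> B u" "\<And>u. u \<in> W \<Longrightarrow> W - {u} \<subseteq> B u"
    and card: "\<And>u. u \<in> W \<Longrightarrow> h * real (card (B u)) \<le> 1 / 2"
  shows "real (card W) * h / 2 \<le>
    measure_pmf.prob (Pi_pmf V False (\<lambda>_. bernoulli_pmf h)) {\<beta>. \<exists>u\<in>W. \<beta> u \<and> (\<forall>w\<in>B u. \<not> \<beta> w)}"
proof -
  let ?P = "Pi_pmf V False (\<lambda>_. bernoulli_pmf h)"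
  define F where "F u = {\<beta>. \<beta> u \<and> (\<forall>w\<in>B u. \<not> \<beta> w)}" for u
  have finW: "finite W" using W fin finite_subset by blast
  have ber: "measure_pmf.prob (bernoulli_pmf h) {True} = h"
    "measure_pmf.prob (bernoulli_pmf h) {False} = 1 - h"
    using h by (simp_all add: measure_pmf_single)
  have prob: "measure_pmf.prob ?P (F u) \<ge> h / 2" if u: "u \<in> W" for u
  proof -
    define S where "S w = (if w = u then {True} else if w \<in> B u then {False} else UNIV)" for w
    have "F u = Pi V S" using u W B[OF u] by (auto simp: F_def S_def Pi_def split: if_splits)
    then have "measure_pmf.prob ?P (F u) = (\<Prod>w\<in>V. measure_pmf.prob (bernoulli_pmf h) (S w))"
      by (simp only: measure_Pi_pmf_Pi[OF fin])
    also have "\<dots> = (\<Prod>w\<in>insert u (B u). measure_pmf.prob (bernoulli_pmf h) (S w))"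
      using u W B[OF u] fin by (intro prod.mono_neutral_right) (auto simp: S_def)
    also have "\<dots> = h * (\<Prod>w\<in>B u. measure_pmf.prob (bernoulli_pmf h) (S w))"
      using B[OF u] fin finite_subset by (subst prod.insert) (auto simp: S_def ber)
    also have "(\<Prod>w\<in>B u. measure_pmf.prob (bernoulli_pmf h) (S w)) = (\<Prod>w\<in>B u. 1 - h)"
      using B(2)[OF u] by (intro prod.cong) (auto simp: S_def ber)
    also have "\<dots> = (1 + (- h)) ^ card (B u)" by simp
    also have "h * \<dots> \<ge> h * (1 / 2)"
    proof (rule mult_left_mono)
      have "1 / 2 \<le> 1 + real (card (B u)) * (- h)" using card[OF u] by (simp add: mult.commute)
      also have "\<dots> \<le> (1 + (- h)) ^ card (B u)" using h by (intro Bernoulli_inequality) simp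
      finally show "1 / 2 \<le> (1 + (- h)) ^ card (B u)" .
    qed (use h in simp)
    finally show ?thesis by simp
  qed
  have disj: "disjoint_family_on F W"
    unfolding disjoint_family_on_def F_def using B(3) by blast
  have "real (card W) * h / 2 = (\<Sum>u\<in>W. h / 2)" by simp
  also have "\<dots> \<le> (\<Sum>u\<in>W. measure_pmf.prob ?P (F u))" by (intro sum_mono prob)
  also have "\<dots> = measure_pmf.prob ?P (\<Union>u\<in>W. F u)"
    using finW disj by (intro measure_pmf.finite_measure_finite_Union[symmetric]) auto
  also have "(\<Union>u\<in>W. F u) = {\<beta>. \<exists>u\<in>W. \<beta> u \<and> (\<forall>w\<in>B u. \<not> \<beta> w)}" by (auto simp: F_def)
  finally show ?thesis .
qed

text \<open>With base 5/4 a coin contributes the factor \<open>1 + h / 4\<close>. Half of the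
  allowed growth is left for the quadratic term of the exponential, so the total is exactly what the
  probability of an isolated success can compensate.\<close>

lemma expectation_power_successes_le:
  fixes h :: real
  assumes fin: "finite V" and h: "0 \<le> h" "h \<le> 1" and W: "W \<subseteq> V" and hW: "h * real (card W) \<le> 1"
  shows "measure_pmf.expectation (Pi_pmf V False (\<lambda>_. bernoulli_pmf h))
    (\<lambda>\<beta>. (5 / 4) ^ card {u\<in>W. \<beta> u}) \<le> 1 + real (card W) * h / 2"
proof -
  let ?P = "Pi_pmf V False (\<lambda>_. bernoulli_pmf h)"
  have finW: "finite W" using W fin finite_subset by blast
  define g :: "_ \<Rightarrow> bool \<Rightarrow> real" where "g u b = (if u \<in> W \<and> b then 5 / 4 else 1)" for u b
  have eq: "(5 / 4) ^ card {u\<in>W. \<beta> u} = (\<Prod>u\<in>V. g u (\<beta> u))" for \<beta>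
  proof -
    have "(\<Prod>u\<in>V. g u (\<beta> u)) = (\<Prod>u\<in>{u\<in>W. \<beta> u}. g u (\<beta> u))"
      using W fin by (intro prod.mono_neutral_right) (auto simp: g_def)
    also have "\<dots> = (\<Prod>u\<in>{u\<in>W. \<beta> u}. 5 / 4)" by (intro prod.cong) (auto simp: g_def)
    finally show ?thesis by simp
  qed
  have "measure_pmf.expectation ?P (\<lambda>\<beta>. (5 / 4) ^ card {u\<in>W. \<beta> u}) =
      (\<Prod>u\<in>V. measure_pmf.expectation (bernoulli_pmf h) (g u))"
    unfolding eq by (rule expectation_prod_Pi_pmf[OF fin])
      (auto intro: integrable_measure_pmf_finite simp: g_def)
  also have "\<dots> = (\<Prod>u\<in>V. if u \<in> W then 1 + h / 4 else 1)"
    using h by (intro prod.cong) (auto simp: g_def field_simps)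
  also have "\<dots> = (1 + h / 4) ^ card W"
    using W fin by (simp add: prod.If_cases Int_absorb1)
  also have "\<dots> \<le> exp (h / 4) ^ card W"
    using h exp_ge_add_one_self[of "h / 4"] by (intro power_mono) auto
  also have "\<dots> = exp (h * real (card W) / 4)" by (simp add: exp_of_nat_mult[symmetric] mult.commute)
  also have "\<dots> \<le> 1 + h * real (card W) / 4 + (h * real (card W) / 4)\<^sup>2"
    using h hW by (intro exp_bound) auto
  also have "\<dots> \<le> 1 + h * real (card W) / 4 + h * real (card W) / 4"
  proof -
    have "(h * real (card W) / 4)\<^sup>2 \<le> (h * real (card W) / 4) * 1"
      unfolding power2_eq_square using h hW by (intro mult_left_mono) auto
    then show ?thesis by simp
  qed
  finally show ?thesis by (simp add: mult.commute)
qed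

text \<open>The conditional probability of slot \<open>r\<close> given that no earlier slot was
  drawn. In block i = \<open>r div L\<close> it is a quarter of the reciprocal of the degree bound
  2^l / 2^i for that block.\<close>

definition hazard :: "nat \<Rightarrow> nat \<Rightarrow> nat \<Rightarrow> real" where
  "hazard l L r = 2 ^ (r div L) / (4 * 2 ^ l)"

text \<open>The value \<open>R\<close> stands for a slot that has not been drawn yet.\<close>
primrec slot_pmf :: "nat \<Rightarrow> nat \<Rightarrow> nat \<Rightarrow> nat \<Rightarrow> nat pmf" where
  "slot_pmf l L R 0 = return_pmf R"
| "slot_pmf l L R (Suc r) = bind_pmf (slot_pmf l L R r)
     (\<lambda>x. map_pmf (\<lambda>b. if x = R \<and> b then r else x) (bernoulli_pmf (hazard l L r)))"

lemma set_slot_pmf: "set_pmf (slot_pmf l L R r) \<subseteq> insert R {..<r}"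
  by (induction r) (auto simp: less_Suc_eq split: if_splits)

definition reveal :: "nat set \<Rightarrow> nat \<Rightarrow> nat \<Rightarrow> (nat \<Rightarrow> nat) \<Rightarrow> (nat \<Rightarrow> bool) \<Rightarrow> nat \<Rightarrow> nat" where
  "reveal V R r \<sigma> \<beta> = (\<lambda>v. if v \<in> V then (if \<sigma> v = R \<and> \<beta> v then r else \<sigma> v) else R)"

abbreviation coins :: "nat set \<Rightarrow> nat \<Rightarrow> nat \<Rightarrow> nat \<Rightarrow> (nat \<Rightarrow> bool) pmf" where
  "coins V l L r \<equiv> Pi_pmf V False (\<lambda>_. bernoulli_pmf (hazard l L r))"

abbreviation slots :: "nat set \<Rightarrow> nat \<Rightarrow> nat \<Rightarrow> nat \<Rightarrow> nat \<Rightarrow> (nat \<Rightarrow> nat) pmf" where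
  "slots V l L R r \<equiv> Pi_pmf V R (\<lambda>_. slot_pmf l L R r)"

text \<open>Deferred decisions: the slots are drawn all at once by the algorithm, but have the same
  joint law as under independent coins tossed slot by slot. Nodes that already have a slot toss too
  and ignore the result, which keeps the coins a product.\<close>

lemma slots_Suc:
  assumes "finite V"
  shows "slots V l L R (Suc r) = bind_pmf (slots V l L R r) (\<lambda>\<sigma>. map_pmf (reveal V R r \<sigma>) (coins V l L r))"
proof -
  have "slots V l L R (Suc r) = bind_pmf (slots V l L R r) (\<lambda>\<sigma>. Pi_pmf V R
      (\<lambda>v. map_pmf (\<lambda>b. if \<sigma> v = R \<and> b then r else \<sigma> v) (bernoulli_pmf (hazard l L r))))"
    unfolding slot_pmf.simps by (rule Pi_pmf_bind[OF assms])
  also have "\<dots> = bind_pmf (slots V l L R r) (\<lambda>\<sigma>. map_pmf (reveal V R r \<sigma>) (coins V l L r))"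
    unfolding reveal_def by (subst Pi_pmf_map_dep[OF assms, where d' = False]) (rule refl)
  finally show ?thesis .
qed

lemma finite_set_slots: "finite V \<Longrightarrow> finite (set_pmf (slots V l L R r))"
  by (intro finite_set_Pi_pmf finite_subset[OF set_slot_pmf]) auto

lemma slots_expectation_Suc_le:
  fixes f g :: "(nat \<Rightarrow> nat) \<Rightarrow> real"
  assumes "finite V" "\<And>\<sigma>. \<sigma> \<in> set_pmf (slots V l L R r) \<Longrightarrow>
    measure_pmf.expectation (coins V l L r) (\<lambda>\<beta>. g (reveal V R r \<sigma> \<beta>)) \<le> f \<sigma>"
  shows "measure_pmf.expectation (slots V l L R (Suc r)) g \<le> measure_pmf.expectation (slots V l L R r) f"
  unfolding slots_Suc[OF assms(1)]
  using assms by (intro expectation_bind_le finite_set_slots) (auto intro!: finite_imageI finite_set_Pi_pmf)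

lemma slot_greedy_cong:
  assumes "\<And>v x. x < r \<Longrightarrow> \<sigma> v = x \<longleftrightarrow> \<sigma>' v = x"
  shows "slot_greedy V E \<sigma> J0 r = slot_greedy V E \<sigma>' J0 r"
  using assms
proof (induction r)
  case (Suc r)
  then have "slot_greedy V E \<sigma> J0 r = slot_greedy V E \<sigma>' J0 r" "\<And>v. \<sigma> v = r \<longleftrightarrow> \<sigma>' v = r" by auto
  then show ?case by simp
qed simp

section \<open>The residual degree after the first phase\<close>

lemma slots_prob_Suc_le:
  assumes "finite V" "\<And>\<sigma>. \<sigma> \<in> set_pmf (slots V l L R r) \<Longrightarrow>
    measure_pmf.prob (coins V l L r) {\<beta>. Q (reveal V R r \<sigma> \<beta>)} \<le> c * of_bool (P \<sigma>)"
  shows "measure_pmf.prob (slots V l L R (Suc r)) {\<sigma>. Q \<sigma>} \<le> c * measure_pmf.prob (slots V l L R r) {\<sigma>. P \<sigma>}"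
proof -
  have E: "measure_pmf.prob p {x. Q x} = measure_pmf.expectation p (\<lambda>x. of_bool (Q x))"
    for p :: "'x pmf" and Q
  proof -
    have "(\<lambda>x. of_bool (Q x) :: real) = indicator {x. Q x}" by (auto simp: indicator_def)
    then show ?thesis by simp
  qed
  have "measure_pmf.expectation (slots V l L R (Suc r)) (\<lambda>\<sigma>. of_bool (Q \<sigma>)) \<le>
      measure_pmf.expectation (slots V l L R r) (\<lambda>\<sigma>. c * of_bool (P \<sigma>))"
    using assms(2) by (intro slots_expectation_Suc_le[OF assms(1)]) (simp only: E)
  then show ?thesis by (simp only: E integral_mult_right_zero)
qed

definition active :: "nat set \<Rightarrow> (nat \<Rightarrow> nat \<Rightarrow> bool) \<Rightarrow> (nat \<Rightarrow> nat) \<Rightarrow> nat \<Rightarrow> nat set" where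
  "active V E \<sigma> r = {v. undominated V E (slot_greedy V E \<sigma> {} r) v \<and> r \<le> \<sigma> v}"

definition active_nbrs :: "nat set \<Rightarrow> (nat \<Rightarrow> nat \<Rightarrow> bool) \<Rightarrow> (nat \<Rightarrow> nat) \<Rightarrow> nat \<Rightarrow> nat \<Rightarrow> nat set" where
  "active_nbrs V E \<sigma> r v = {u \<in> active V E \<sigma> r. E v u}"

text \<open>Such a neighbour was undominated in its own slot and still did not join, so it collided
  with an undominated neighbour of the same slot.\<close>

definition spoiled_nbrs :: "nat set \<Rightarrow> (nat \<Rightarrow> nat \<Rightarrow> bool) \<Rightarrow> (nat \<Rightarrow> nat) \<Rightarrow> nat \<Rightarrow> nat \<Rightarrow> nat set" where
  "spoiled_nbrs V E \<sigma> r v = {u. E v u \<and> undominated V E (slot_greedy V E \<sigma> {} r) u \<and> \<sigma> u < r}"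

text \<open>All block boundaries passed so far are included, so the property, once lost, is never
  regained.\<close>

definition degrees_ok :: "nat set \<Rightarrow> (nat \<Rightarrow> nat \<Rightarrow> bool) \<Rightarrow> nat \<Rightarrow> nat \<Rightarrow> (nat \<Rightarrow> nat) \<Rightarrow> nat \<Rightarrow> bool" where
  "degrees_ok V E l L \<sigma> r \<longleftrightarrow> (\<forall>i v. i * L \<le> r \<and> undominated V E (slot_greedy V E \<sigma> {} (i * L)) v \<longrightarrow>
     real (card (active_nbrs V E \<sigma> (i * L) v)) \<le> 2 ^ l / 2 ^ i)"

lemma undominated_slot_greedy_antimono:
  "r \<le> r' \<Longrightarrow> undominated V E (slot_greedy V E \<sigma> J0 r') v \<Longrightarrow> undominated V E (slot_greedy V E \<sigma> J0 r) v"
  by (rule undominated_antimono[OF slot_greedy_mono])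

lemma active_nbrs_antimono: "r \<le> r' \<Longrightarrow> active_nbrs V E \<sigma> r' v \<subseteq> active_nbrs V E \<sigma> r v"
  unfolding active_nbrs_def active_def using undominated_slot_greedy_antimono by fastforce

lemma degrees_ok_antimono: "r \<le> r' \<Longrightarrow> degrees_ok V E l L \<sigma> r' \<Longrightarrow> degrees_ok V E l L \<sigma> r"
  unfolding degrees_ok_def using order_trans by blast

text \<open>The value also drops to 0 when a degree bound fails, because the hazard can then be too
  large for the coin estimates. Both conditions for a nonzero value can only be lost, so the process
  never leaves 0 again.\<close>

definition potential ::
    "nat set \<Rightarrow> (nat \<Rightarrow> nat \<Rightarrow> bool) \<Rightarrow> nat \<Rightarrow> nat \<Rightarrow> nat \<Rightarrow> nat \<Rightarrow> (nat \<Rightarrow> nat) \<Rightarrow> real" where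
  "potential V E l L r v \<sigma> =
     (if degrees_ok V E l L \<sigma> r \<and> undominated V E (slot_greedy V E \<sigma> {} r) v
      then (5 / 4) ^ card (spoiled_nbrs V E \<sigma> r v) else 0)"

context
  fixes V :: "nat set" and E :: "nat \<Rightarrow> nat \<Rightarrow> bool" and l L R :: nat
  assumes sg: "simple_graph V E" and L: "L \<ge> 1" and R: "R = Suc l * L" and card_V: "card V \<le> 2 ^ l"
begin

private abbreviation "J \<equiv> \<lambda>\<sigma>. slot_greedy V E \<sigma> {}"
private abbreviation "und \<equiv> \<lambda>\<sigma> r. undominated V E (J \<sigma> r)"

private lemma finV: "finite V" using sg by (simp add: simple_graph_def)

private lemma E_sym: "E u v \<Longrightarrow> E v u" using sg by (simp add: simple_graph_def)

private lemma finite_nbrs: "finite (active_nbrs V E \<sigma> r v)" "finite (spoiled_nbrs V E \<sigma> r v)"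
  by (rule finite_subset[OF _ finV]; auto simp: active_nbrs_def active_def spoiled_nbrs_def undominated_def)+

lemma hazard_bounds: "r < R \<Longrightarrow> 0 \<le> hazard l L r" "r < R \<Longrightarrow> hazard l L r \<le> 1"
proof -
  assume "r < R"
  then have "r div L < Suc l" using R by (simp add: less_mult_imp_div_less)
  then have "(2::real) ^ (r div L) \<le> 2 ^ l" by (intro power_increasing) auto
  also have "(2::real) ^ l \<le> 4 * 2 ^ l" by simp
  finally show "hazard l L r \<le> 1" by (simp add: hazard_def)
qed (simp add: hazard_def)

section \<open>Effect of one round of coins\<close>

context
  fixes r :: nat and \<sigma> :: "nat \<Rightarrow> nat"
  assumes \<sigma>: "\<sigma> \<in> set_pmf (slots V l L R r)" and r: "r < R"
begin

private abbreviation "\<sigma>' \<equiv> reveal V R r \<sigma>"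

lemma slots_cases: "\<sigma> v < r \<or> \<sigma> v = R" "v \<notin> V \<Longrightarrow> \<sigma> v = R"
proof -
  have "\<sigma> \<in> PiE_dflt V R (set_pmf \<circ> (\<lambda>_. slot_pmf l L R r))" using \<sigma> set_Pi_pmf[OF finV] by metis
  then have "\<And>v. v \<in> V \<Longrightarrow> \<sigma> v \<in> insert R {..<r}" "\<And>v. v \<notin> V \<Longrightarrow> \<sigma> v = R"
    using set_slot_pmf[of l L R r] by (auto simp: PiE_dflt_def)
  then show "\<sigma> v < r \<or> \<sigma> v = R" "v \<notin> V \<Longrightarrow> \<sigma> v = R" by (cases "v \<in> V"; auto)+
qed

lemma reveal_less: "x < r \<Longrightarrow> \<sigma>' \<beta> v = x \<longleftrightarrow> \<sigma> v = x"
  using slots_cases[of v] r by (auto simp: reveal_def)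

lemma reveal_eq: "\<sigma>' \<beta> v = r \<longleftrightarrow> v \<in> V \<and> \<sigma> v = R \<and> \<beta> v"
  using slots_cases[of v] r by (auto simp: reveal_def)

lemma reveal_ge: "r' \<le> r \<Longrightarrow> r' \<le> \<sigma>' \<beta> v \<longleftrightarrow> r' \<le> \<sigma> v"
  using slots_cases[of v] r by (auto simp: reveal_def)

lemma reveal_greedy: "r' \<le> r \<Longrightarrow> J (\<sigma>' \<beta>) r' = J \<sigma> r'"
  by (intro slot_greedy_cong reveal_less) simp

lemma reveal_active: "r' \<le> r \<Longrightarrow> active V E (\<sigma>' \<beta>) r' = active V E \<sigma> r'"
  unfolding active_def by (simp add: reveal_greedy reveal_ge)

lemma reveal_active_nbrs: "r' \<le> r \<Longrightarrow> active_nbrs V E (\<sigma>' \<beta>) r' = active_nbrs V E \<sigma> r'"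
  unfolding active_nbrs_def by (simp add: reveal_active)

lemma reveal_degrees_ok: "r' \<le> r \<Longrightarrow> degrees_ok V E l L (\<sigma>' \<beta>) r' \<longleftrightarrow> degrees_ok V E l L \<sigma> r'"
  unfolding degrees_ok_def by (intro all_cong1) (auto simp: reveal_greedy reveal_active_nbrs)

lemma active_unset: "active V E \<sigma> r = {v. und \<sigma> r v \<and> \<sigma> v = R}"
  using slots_cases(1) r by (force simp: active_def)

lemma reveal_und: "und (\<sigma>' \<beta>) (Suc r) v \<Longrightarrow> und \<sigma> r v"
  using undominated_slot_greedy_antimono[of r "Suc r" V E "\<sigma>' \<beta>" "{}" v]
  by (simp only: reveal_greedy[OF order_refl] le_SucI order_refl)

lemma reveal_spoiled:
  "spoiled_nbrs V E (\<sigma>' \<beta>) (Suc r) v \<subseteq> spoiled_nbrs V E \<sigma> r v \<union> {u \<in> active_nbrs V E \<sigma> r v. \<beta> u}"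
proof
  fix u assume u: "u \<in> spoiled_nbrs V E (\<sigma>' \<beta>) (Suc r) v"
  then have E: "E v u" "und \<sigma> r u" and lt: "\<sigma>' \<beta> u < Suc r" using reveal_und by (auto simp: spoiled_nbrs_def)
  show "u \<in> spoiled_nbrs V E \<sigma> r v \<union> {u \<in> active_nbrs V E \<sigma> r v. \<beta> u}"
  proof (cases "\<sigma>' \<beta> u = r")
    case True
    then show ?thesis using E reveal_eq by (auto simp: active_nbrs_def active_unset)
  next
    case False
    then have "\<sigma> u < r" using lt reveal_ge[of r \<beta> u] by auto
    then show ?thesis using E by (auto simp: spoiled_nbrs_def)
  qed
qed

lemma reveal_active_nbrs_Suc: "active_nbrs V E (\<sigma>' \<beta>) (Suc r) v \<subseteq> active_nbrs V E \<sigma> r v"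
  using active_nbrs_antimono[of r "Suc r" V E "\<sigma>' \<beta>" v] reveal_active_nbrs[of r] by simp

lemma degrees_ok_active_nbrs:
  assumes "degrees_ok V E l L \<sigma> (r div L * L)" "und \<sigma> r v"
  shows "real (card (active_nbrs V E \<sigma> r v)) \<le> 2 ^ l / 2 ^ (r div L)"
proof -
  have le: "r div L * L \<le> r" by simp
  have "card (active_nbrs V E \<sigma> r v) \<le> card (active_nbrs V E \<sigma> (r div L * L) v)"
    by (intro card_mono finite_nbrs active_nbrs_antimono le)
  moreover have "und \<sigma> (r div L * L) v" using undominated_slot_greedy_antimono[OF le assms(2)] .
  ultimately show ?thesis using assms(1) unfolding degrees_ok_def
    by (meson of_nat_le_iff order_refl order_trans)
qed

lemma hazard_active_nbrs:
  assumes "degrees_ok V E l L \<sigma> (r div L * L)" "und \<sigma> r v"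
  shows "hazard l L r * real (card (active_nbrs V E \<sigma> r v)) \<le> 1 / 4"
proof -
  have "hazard l L r * real (card (active_nbrs V E \<sigma> r v)) \<le> hazard l L r * (2 ^ l / 2 ^ (r div L))"
    by (intro mult_left_mono degrees_ok_active_nbrs assms) (simp add: hazard_def)
  also have "\<dots> = 1 / 4" by (simp add: hazard_def)
  finally show ?thesis .
qed

text \<open>A neighbour that is marked while no other node in its neighbourhood and that of \<open>v\<close> is
  marked joins. These events are disjoint for different neighbours, so their probabilities add up.\<close>
lemma prob_dominated_ge:
  assumes ok: "degrees_ok V E l L \<sigma> (r div L * L)" and v: "und \<sigma> r v"
  shows "real (card (active_nbrs V E \<sigma> r v)) * hazard l L r / 2 \<le>
    measure_pmf.prob (coins V l L r) {\<beta>. \<not> und (\<sigma>' \<beta>) (Suc r) v}"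
proof -
  let ?W = "active_nbrs V E \<sigma> r v"
  define B where "B u = (active_nbrs V E \<sigma> r u \<union> ?W) - {u}" for u
  have sub: "active_nbrs V E \<sigma> r u \<subseteq> V" for u by (auto simp: active_nbrs_def active_def undominated_def)
  have "real (card ?W) * hazard l L r / 2 \<le>
      measure_pmf.prob (coins V l L r) {\<beta>. \<exists>u\<in>?W. \<beta> u \<and> (\<forall>w\<in>B u. \<not> \<beta> w)}"
  proof (rule prob_isolated_success_ge[OF finV hazard_bounds[OF r]])
    fix u assume u: "u \<in> ?W"
    then have "und \<sigma> r u" by (auto simp: active_nbrs_def active_def)
    have "card (B u) \<le> card (active_nbrs V E \<sigma> r u \<union> ?W)"
      unfolding B_def by (intro card_mono) (auto simp: finite_nbrs)
    also have "\<dots> \<le> card (active_nbrs V E \<sigma> r u) + card ?W" by (rule card_Un_le)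
    finally have "hazard l L r * real (card (B u)) \<le>
        hazard l L r * (real (card (active_nbrs V E \<sigma> r u)) + real (card ?W))"
      using hazard_bounds(1)[OF r] by (intro mult_left_mono) linarith+
    \<comment> \<open>Both \<open>u\<close> and \<open>v\<close> are undominated, so each of the two
      neighbourhoods times the hazard is at most 1/4; this is where the 4 in the hazard is
      needed.\<close>
    also have "\<dots> \<le> 1 / 4 + 1 / 4"
      unfolding distrib_left by (intro add_mono hazard_active_nbrs ok v) fact
    finally show "hazard l L r * real (card (B u)) \<le> 1 / 2" by simp
  qed (use sub in \<open>auto simp: B_def\<close>)
  also have "\<dots> \<le> measure_pmf.prob (coins V l L r) {\<beta>. \<not> und (\<sigma>' \<beta>) (Suc r) v}"
  proof (rule measure_pmf.finite_measure_mono)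
    show "{\<beta>. \<exists>u\<in>?W. \<beta> u \<and> (\<forall>w\<in>B u. \<not> \<beta> w)} \<subseteq> {\<beta>. \<not> und (\<sigma>' \<beta>) (Suc r) v}"
    proof clarify
      fix \<beta> u assume u: "u \<in> ?W" "\<beta> u" "\<forall>w\<in>B u. \<not> \<beta> w" and und: "und (\<sigma>' \<beta>) (Suc r) v"
      have act: "und \<sigma> r u" "\<sigma> u = R" "E v u" "u \<in> V"
        using u(1) by (auto simp: active_nbrs_def active_unset undominated_def)
      have "\<not> und \<sigma> r w" if w: "E u w" "\<sigma>' \<beta> w = r" for w
      proof
        assume "und \<sigma> r w"
        then have "w \<in> active_nbrs V E \<sigma> r u" "\<beta> w" using w reveal_eq by (auto simp: active_nbrs_def active_unset)
        moreover have "w \<noteq> u" using w sg by (auto simp: simple_graph_def)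
        ultimately show False using u(3) by (auto simp: B_def)
      qed
      then have "u \<in> J (\<sigma>' \<beta>) (Suc r)"
        using act u(2) reveal_eq[of \<beta> u] by (simp add: reveal_greedy)
      then show False using und act(3) by (auto simp only: undominated_def)
    qed
  qed simp
  finally show ?thesis .
qed

lemma prob_und_le:
  assumes "degrees_ok V E l L \<sigma> (r div L * L)" "und \<sigma> r v"
  shows "measure_pmf.prob (coins V l L r) {\<beta>. und (\<sigma>' \<beta>) (Suc r) v} \<le>
    1 - real (card (active_nbrs V E \<sigma> r v)) * hazard l L r / 2"
proof -
  have "{\<beta>. \<not> und (\<sigma>' \<beta>) (Suc r) v} = space (coins V l L r) - {\<beta>. und (\<sigma>' \<beta>) (Suc r) v}" by auto
  then have "measure_pmf.prob (coins V l L r) {\<beta>. \<not> und (\<sigma>' \<beta>) (Suc r) v} =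
      1 - measure_pmf.prob (coins V l L r) {\<beta>. und (\<sigma>' \<beta>) (Suc r) v}"
    by (simp only:) (rule measure_pmf.prob_compl, simp)
  then show ?thesis using prob_dominated_ge[OF assms] by simp
qed

text \<open>Newly spoiled neighbours raise the expectation of the power by a factor of at most \<open>1 + d h / 2\<close>,
  which the probability \<open>d h / 2\<close> of being dominated makes up for.\<close>
lemma potential_step:
  "measure_pmf.expectation (coins V l L r) (\<lambda>\<beta>. potential V E l L (Suc r) v (\<sigma>' \<beta>)) \<le> potential V E l L r v \<sigma>"
proof (cases "degrees_ok V E l L \<sigma> r \<and> und \<sigma> r v")
  case False
  have "potential V E l L (Suc r) v (\<sigma>' \<beta>) = 0" for \<beta>
  proof -
    have "degrees_ok V E l L (\<sigma>' \<beta>) (Suc r) \<Longrightarrow> degrees_ok V E l L \<sigma> r"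
      using reveal_degrees_ok[of r \<beta>] degrees_ok_antimono[of r "Suc r"] by simp
    then show ?thesis using False reveal_und[of \<beta> v] unfolding potential_def by auto
  qed
  then show ?thesis using False by (simp add: potential_def)
next
  case True
  let ?W = "active_nbrs V E \<sigma> r v" and ?x = "(5 / 4 :: real) ^ card (spoiled_nbrs V E \<sigma> r v)"
  let ?D = "{\<beta>. \<not> und (\<sigma>' \<beta>) (Suc r) v}"
  have ok: "degrees_ok V E l L \<sigma> (r div L * L)" using True degrees_ok_antimono[of "r div L * L" r] by simp
  have fin: "finite (set_pmf (coins V l L r))" by (intro finite_set_Pi_pmf finV) auto
  note int = integrable_measure_pmf_finite[OF fin]
  \<comment> \<open>Where \<open>v\<close> becomes dominated the left side is 0, and the power is at
    least 1, so the indicator can be subtracted. It turns the domination probability into the gain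
    that offsets the growth.\<close>
  have "potential V E l L (Suc r) v (\<sigma>' \<beta>) \<le> ?x * ((5 / 4) ^ card {u\<in>?W. \<beta> u} - indicator ?D \<beta>)" for \<beta>
  proof (cases "und (\<sigma>' \<beta>) (Suc r) v")
    case True
    have "card (spoiled_nbrs V E (\<sigma>' \<beta>) (Suc r) v) \<le> card (spoiled_nbrs V E \<sigma> r v \<union> {u\<in>?W. \<beta> u})"
      using reveal_spoiled finite_nbrs by (intro card_mono) auto
    also have "\<dots> \<le> card (spoiled_nbrs V E \<sigma> r v) + card {u\<in>?W. \<beta> u}" by (rule card_Un_le)
    finally have "(5 / 4 :: real) ^ card (spoiled_nbrs V E (\<sigma>' \<beta>) (Suc r) v) \<le>
        (5 / 4) ^ (card (spoiled_nbrs V E \<sigma> r v) + card {u\<in>?W. \<beta> u})"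
      by (intro power_increasing) auto
    then show ?thesis using True by (simp add: potential_def power_add)
  next
    case False
    then show ?thesis by (simp add: potential_def)
  qed
  then have "measure_pmf.expectation (coins V l L r) (\<lambda>\<beta>. potential V E l L (Suc r) v (\<sigma>' \<beta>)) \<le>
      measure_pmf.expectation (coins V l L r) (\<lambda>\<beta>. ?x * ((5 / 4) ^ card {u\<in>?W. \<beta> u} - indicator ?D \<beta>))"
    by (intro integral_mono int)
  also have "\<dots> = ?x * (measure_pmf.expectation (coins V l L r) (\<lambda>\<beta>. (5 / 4) ^ card {u\<in>?W. \<beta> u})
      - measure_pmf.prob (coins V l L r) ?D)"
    using int by (subst integral_mult_right_zero, subst Bochner_Integration.integral_diff) auto
  also have "\<dots> \<le> ?x * 1"
  proof (rule mult_left_mono)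
    have "?W \<subseteq> V" by (auto simp: active_nbrs_def active_def undominated_def)
    moreover have "hazard l L r * real (card ?W) \<le> 1"
      using hazard_active_nbrs[OF ok] True by fastforce
    ultimately have "measure_pmf.expectation (coins V l L r) (\<lambda>\<beta>. (5 / 4) ^ card {u\<in>?W. \<beta> u})
        \<le> 1 + real (card ?W) * hazard l L r / 2"
      by (intro expectation_power_successes_le finV hazard_bounds[OF r])
    then show "measure_pmf.expectation (coins V l L r) (\<lambda>\<beta>. (5 / 4) ^ card {u\<in>?W. \<beta> u})
      - measure_pmf.prob (coins V l L r) ?D \<le> 1"
      using prob_dominated_ge[OF ok] True by fastforce
  qed simp
  finally show ?thesis using True by (simp add: potential_def)
qed

end

section \<open>Spoiled neighbours and active degrees over the whole phase\<close>

lemma potential_le_1: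
  assumes "r \<le> R"
  shows "measure_pmf.expectation (slots V l L R r) (potential V E l L r v) \<le> 1"
  using assms
proof (induction r)
  case 0
  have "potential V E l L 0 v \<sigma> \<le> 1" for \<sigma> by (simp add: potential_def spoiled_nbrs_def)
  then have "measure_pmf.expectation (slots V l L R 0) (potential V E l L 0 v) \<le>
      measure_pmf.expectation (slots V l L R 0) (\<lambda>_. 1)"
    by (intro integral_mono integrable_measure_pmf_finite finite_set_slots finV)
  then show ?case by simp
next
  case (Suc r)
  have "measure_pmf.expectation (slots V l L R (Suc r)) (potential V E l L (Suc r) v) \<le>
      measure_pmf.expectation (slots V l L R r) (potential V E l L r v)"
    using Suc.prems by (intro slots_expectation_Suc_le finV potential_step) auto
  then show ?case using Suc by simp
qed

text \<open>Markov's inequality for the potential, whose expectation is at most 1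
  throughout.\<close>

lemma prob_spoiled_le:
  "measure_pmf.prob (slots V l L R R)
     {\<sigma>. degrees_ok V E l L \<sigma> R \<and> und \<sigma> R v \<and> card (spoiled_nbrs V E \<sigma> R v) > D} \<le> (4 / 5) ^ D"
proof -
  let ?A = "{\<sigma>. degrees_ok V E l L \<sigma> R \<and> und \<sigma> R v \<and> card (spoiled_nbrs V E \<sigma> R v) > D}"
  let ?p = "slots V l L R R"
  note int = integrable_measure_pmf_finite[OF finite_set_slots[OF finV]]
  have "indicator ?A \<sigma> \<le> (4 / 5) ^ D * potential V E l L R v \<sigma>" for \<sigma>
  proof (cases "\<sigma> \<in> ?A")
    case True
    have "(1::real) = (4 / 5) ^ D * (5 / 4) ^ D" by (simp add: power_mult_distrib[symmetric])
    also have "\<dots> \<le> (4 / 5) ^ D * (5 / 4) ^ card (spoiled_nbrs V E \<sigma> R v)"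
      using True by (intro mult_left_mono power_increasing) auto
    finally show ?thesis using True by (simp add: potential_def)
  qed (simp add: potential_def)
  then have "measure_pmf.expectation ?p (indicator ?A) \<le>
      measure_pmf.expectation ?p (\<lambda>\<sigma>. (4 / 5) ^ D * potential V E l L R v \<sigma>)"
    by (intro integral_mono int)
  also have "\<dots> = (4 / 5) ^ D * measure_pmf.expectation ?p (potential V E l L R v)" by simp
  also have "\<dots> \<le> (4 / 5) ^ D * 1" by (intro mult_left_mono potential_le_1) auto
  finally show ?thesis by simp
qed

text \<open>While more than half of the allowed active degree d remains, d times the hazard is at
  least 1/8, so \<open>v\<close> survives a slot undominated with probability at most 1 - 1/16.
  Active degrees never grow, so the event after \<open>j + 1\<close> slots requires the one after
  \<open>j\<close>.\<close>

lemma prob_high_degree_le: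
  assumes "i \<le> l" "j \<le> L"
  shows "measure_pmf.prob (slots V l L R (i * L + j))
    {\<sigma>. degrees_ok V E l L \<sigma> (i * L) \<and> und \<sigma> (i * L + j) v \<and>
         real (card (active_nbrs V E \<sigma> (i * L + j) v)) > 2 ^ l / 2 ^ Suc i} \<le> (15 / 16) ^ j"
  using assms(2)
proof (induction j)
  case (Suc j)
  let ?H = "\<lambda>j \<sigma>. degrees_ok V E l L \<sigma> (i * L) \<and> und \<sigma> (i * L + j) v \<and>
         real (card (active_nbrs V E \<sigma> (i * L + j) v)) > 2 ^ l / 2 ^ Suc i"
  define r where "r = i * L + j"
  have "Suc i * L \<le> R" using assms(1) unfolding R by (intro mult_le_mono1) simp
  then have rR: "r < R" using Suc.prems by (simp add: r_def)
  have div: "r div L = i" using Suc.prems by (simp add: r_def)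
  have "measure_pmf.prob (slots V l L R (Suc r)) {\<sigma>. ?H (Suc j) \<sigma>} \<le>
      15 / 16 * measure_pmf.prob (slots V l L R r) {\<sigma>. ?H j \<sigma>}"
  proof (rule slots_prob_Suc_le[OF finV])
    fix \<sigma> assume \<sigma>: "\<sigma> \<in> set_pmf (slots V l L R r)"
    let ?\<sigma>' = "reveal V R r \<sigma>"
    have H: "?H j \<sigma>" if "?H (Suc j) (?\<sigma>' \<beta>)" for \<beta>
    proof -
      have "card (active_nbrs V E (?\<sigma>' \<beta>) (Suc r) v) \<le> card (active_nbrs V E \<sigma> r v)"
        by (intro card_mono finite_nbrs reveal_active_nbrs_Suc[OF \<sigma> rR])
      then show ?thesis
        using that reveal_degrees_ok[OF \<sigma> rR, of "i * L" \<beta>] reveal_und[OF \<sigma> rR, of \<beta> v]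
        by (simp del: slot_greedy.simps add: r_def)
    qed
    show "measure_pmf.prob (coins V l L r) {\<beta>. ?H (Suc j) (?\<sigma>' \<beta>)} \<le> 15 / 16 * of_bool (?H j \<sigma>)"
    proof (cases "?H j \<sigma>")
      case False
      then have empty: "{\<beta>. ?H (Suc j) (?\<sigma>' \<beta>)} = {}" using H by blast
      show ?thesis unfolding empty by simp
    next
      case True
      let ?d = "real (card (active_nbrs V E \<sigma> r v))"
      have ok: "degrees_ok V E l L \<sigma> (r div L * L)" "und \<sigma> r v" using True div by (auto simp: r_def)
      have "measure_pmf.prob (coins V l L r) {\<beta>. ?H (Suc j) (?\<sigma>' \<beta>)} \<le>
          measure_pmf.prob (coins V l L r) {\<beta>. und (?\<sigma>' \<beta>) (Suc r) v}"
        by (intro measure_pmf.finite_measure_mono) (auto simp: r_def simp del: slot_greedy.simps)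
      also have "\<dots> \<le> 1 - ?d * hazard l L r / 2" by (rule prob_und_le[OF \<sigma> rR ok])
      also have "\<dots> \<le> 15 / 16"
      proof -
        have "(2 ^ l / 2 ^ Suc i) * hazard l L r \<le> ?d * hazard l L r"
          using True by (intro mult_right_mono) (auto simp: r_def hazard_def)
        moreover have "(2 ^ l / 2 ^ Suc i) * hazard l L r = 1 / 8" by (simp add: hazard_def div)
        ultimately show ?thesis by linarith
      qed
      finally show ?thesis using True by simp
    qed
  qed
  also have "\<dots> \<le> 15 / 16 * (15 / 16) ^ j" using Suc unfolding r_def by (intro mult_left_mono) auto
  finally show ?case by (simp add: r_def)
qed simp

text \<open>Whether the bounds hold up to \<open>r0\<close> depends only on slots below
  \<open>r0\<close>; later coins cannot change it.\<close>

lemma prob_not_degrees_ok_stable: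
  assumes "r0 + j \<le> R"
  shows "measure_pmf.prob (slots V l L R (r0 + j)) {\<sigma>. \<not> degrees_ok V E l L \<sigma> r0} \<le>
    measure_pmf.prob (slots V l L R r0) {\<sigma>. \<not> degrees_ok V E l L \<sigma> r0}"
  using assms
proof (induction j)
  case (Suc j)
  have "measure_pmf.prob (slots V l L R (Suc (r0 + j))) {\<sigma>. \<not> degrees_ok V E l L \<sigma> r0} \<le>
      1 * measure_pmf.prob (slots V l L R (r0 + j)) {\<sigma>. \<not> degrees_ok V E l L \<sigma> r0}"
  proof (rule slots_prob_Suc_le[OF finV])
    fix \<sigma> assume \<sigma>: "\<sigma> \<in> set_pmf (slots V l L R (r0 + j))"
    have "r0 + j < R" using Suc.prems by simp
    then show "measure_pmf.prob (coins V l L (r0 + j)) {\<beta>. \<not> degrees_ok V E l L (reveal V R (r0 + j) \<sigma> \<beta>) r0}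
        \<le> 1 * of_bool (\<not> degrees_ok V E l L \<sigma> r0)"
      using reveal_degrees_ok[OF \<sigma>, of r0] by (cases "degrees_ok V E l L \<sigma> r0") auto
  qed
  then show ?case using Suc by simp
qed simp

text \<open>A new violation at a boundary means that some node kept more than half of its allowance
  through the whole block; this is summed over nodes and blocks. At the start
  \<open>card V <= 2 ^ l\<close> gives the bound for free.\<close>

lemma prob_not_degrees_ok_le:
  assumes "i \<le> Suc l"
  shows "measure_pmf.prob (slots V l L R (i * L)) {\<sigma>. \<not> degrees_ok V E l L \<sigma> (i * L)} \<le>
    real i * (real (card V) * (15 / 16) ^ L)"
  using assms
proof (induction i)
  case 0
  have "degrees_ok V E l L \<sigma> 0" for \<sigma>
  proof -
    have "card (active_nbrs V E \<sigma> 0 v) \<le> card V" for v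
      by (intro card_mono finV) (auto simp: active_nbrs_def active_def undominated_def)
    then have "real (card (active_nbrs V E \<sigma> 0 v)) \<le> 2 ^ l" for v
      using card_V order_trans by (metis of_nat_le_iff of_nat_numeral of_nat_power)
    then show ?thesis using L by (auto simp: degrees_ok_def)
  qed
  then show ?case by simp
next
  case (Suc i)
  let ?p = "slots V l L R (i * L + L)"
  let ?H = "\<lambda>v. {\<sigma>. degrees_ok V E l L \<sigma> (i * L) \<and> und \<sigma> (i * L + L) v \<and>
         real (card (active_nbrs V E \<sigma> (i * L + L) v)) > 2 ^ l / 2 ^ Suc i}"
  have "{\<sigma>. \<not> degrees_ok V E l L \<sigma> (Suc i * L)} \<subseteq> {\<sigma>. \<not> degrees_ok V E l L \<sigma> (i * L)} \<union> (\<Union>v\<in>V. ?H v)"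
  proof
    fix \<sigma> assume "\<sigma> \<in> {\<sigma>. \<not> degrees_ok V E l L \<sigma> (Suc i * L)}"
    then obtain i' v where i': "i' * L \<le> Suc i * L" "und \<sigma> (i' * L) v"
      "real (card (active_nbrs V E \<sigma> (i' * L) v)) > 2 ^ l / 2 ^ i'"
      by (auto simp: degrees_ok_def not_le simp del: mult_Suc)
    then have "i' \<le> Suc i" using L by (auto simp only: mult_le_cancel2)
    show "\<sigma> \<in> {\<sigma>. \<not> degrees_ok V E l L \<sigma> (i * L)} \<union> (\<Union>v\<in>V. ?H v)"
    proof (cases "i' = Suc i")
      case True
      moreover have "v \<in> V" using i' by (simp add: undominated_def)
      ultimately show ?thesis using i' by (auto simp: add.commute)
    next
      case False
      then have "i' * L \<le> i * L" using \<open>i' \<le> Suc i\<close> by (intro mult_le_mono1) simp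
      then show ?thesis using i' by (auto simp: degrees_ok_def not_le)
    qed
  qed
  then have "measure_pmf.prob ?p {\<sigma>. \<not> degrees_ok V E l L \<sigma> (Suc i * L)} \<le>
      measure_pmf.prob ?p ({\<sigma>. \<not> degrees_ok V E l L \<sigma> (i * L)} \<union> (\<Union>v\<in>V. ?H v))"
    by (intro measure_pmf.finite_measure_mono) auto
  also have "\<dots> \<le> measure_pmf.prob ?p {\<sigma>. \<not> degrees_ok V E l L \<sigma> (i * L)} + measure_pmf.prob ?p (\<Union>v\<in>V. ?H v)"
    by (intro measure_Un_le) auto
  also have "\<dots> \<le> real i * (real (card V) * (15 / 16) ^ L) + real (card V) * (15 / 16) ^ L"
  proof (rule add_mono)
    have "Suc i * L \<le> R" using Suc.prems unfolding R by (rule mult_le_mono1)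
    then show "measure_pmf.prob ?p {\<sigma>. \<not> degrees_ok V E l L \<sigma> (i * L)} \<le> real i * (real (card V) * (15 / 16) ^ L)"
      using prob_not_degrees_ok_stable[of "i * L" L] Suc by simp
    have "measure_pmf.prob ?p (\<Union>v\<in>V. ?H v) \<le> (\<Sum>v\<in>V. measure_pmf.prob ?p (?H v))"
      by (intro measure_UNION_le finV) auto
    also have "\<dots> \<le> (\<Sum>v\<in>V. (15 / 16) ^ L)"
      using Suc.prems by (intro sum_mono prob_high_degree_le) auto
    finally show "measure_pmf.prob ?p (\<Union>v\<in>V. ?H v) \<le> real (card V) * (15 / 16) ^ L" by simp
  qed
  finally show ?case by (simp add: algebra_simps)
qed

text \<open>After \<open>l + 1\<close> blocks the degree bound is 2^l / 2^(l + 1) < 1, so no active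
  neighbours are left and every residual neighbour is spoiled. The phase itself has
  \<open>K >= R\<close> slots, and further slots only shrink the residual graph.\<close>

lemma prob_residual_degree_le:
  assumes K: "R \<le> K"
  shows "measure_pmf.prob (slots V l L R R)
      {\<sigma>. \<exists>v. und \<sigma> K v \<and> card (residual_nbrs V E (J \<sigma> K) v) > D} \<le>
    real (card V) * (real (Suc l) * (15 / 16) ^ L + (4 / 5) ^ D)"
proof -
  let ?p = "slots V l L R R"
  let ?S = "\<lambda>v. {\<sigma>. degrees_ok V E l L \<sigma> R \<and> und \<sigma> R v \<and> card (spoiled_nbrs V E \<sigma> R v) > D}"
  have "{\<sigma>. \<exists>v. und \<sigma> K v \<and> card (residual_nbrs V E (J \<sigma> K) v) > D} \<subseteq>
      {\<sigma>. \<not> degrees_ok V E l L \<sigma> R} \<union> (\<Union>v\<in>V. ?S v)"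
  proof clarify
    fix \<sigma> v assume v: "und \<sigma> K v" "card (residual_nbrs V E (J \<sigma> K) v) > D" and nS: "\<sigma> \<notin> (\<Union>v\<in>V. ?S v)"
      and ok: "degrees_ok V E l L \<sigma> R"
    have und: "und \<sigma> R v" by (rule undominated_slot_greedy_antimono[OF K v(1)])
    have "real (card (active_nbrs V E \<sigma> R v)) \<le> 2 ^ l / 2 ^ Suc l"
      using ok und unfolding degrees_ok_def R by blast
    also have "\<dots> < 1" by simp
    finally have "active_nbrs V E \<sigma> R v = {}" using finite_nbrs by simp
    moreover have "und \<sigma> R u" if "und \<sigma> K u" for u by (rule undominated_slot_greedy_antimono[OF K that])
    ultimately have "residual_nbrs V E (J \<sigma> K) v \<subseteq> spoiled_nbrs V E \<sigma> R v"
      by (auto simp: residual_nbrs_def active_nbrs_def active_def spoiled_nbrs_def not_le[symmetric])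
    then have "card (spoiled_nbrs V E \<sigma> R v) > D"
      using v(2) card_mono[OF finite_nbrs(2)] by (meson order_less_le_trans)
    moreover have "v \<in> V" using v by (simp add: undominated_def)
    ultimately show False using nS ok und by blast
  qed
  then have "measure_pmf.prob ?p {\<sigma>. \<exists>v. und \<sigma> K v \<and> card (residual_nbrs V E (J \<sigma> K) v) > D} \<le>
      measure_pmf.prob ?p ({\<sigma>. \<not> degrees_ok V E l L \<sigma> R} \<union> (\<Union>v\<in>V. ?S v))"
    by (intro measure_pmf.finite_measure_mono) auto
  also have "\<dots> \<le> measure_pmf.prob ?p {\<sigma>. \<not> degrees_ok V E l L \<sigma> R} + measure_pmf.prob ?p (\<Union>v\<in>V. ?S v)"
    by (intro measure_Un_le) auto
  also have "\<dots> \<le> real (Suc l) * (real (card V) * (15 / 16) ^ L) + real (card V) * (4 / 5) ^ D"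
  proof (rule add_mono)
    show "measure_pmf.prob ?p {\<sigma>. \<not> degrees_ok V E l L \<sigma> R} \<le> real (Suc l) * (real (card V) * (15 / 16) ^ L)"
      using prob_not_degrees_ok_le[of "Suc l"] unfolding R by simp
    have "measure_pmf.prob ?p (\<Union>v\<in>V. ?S v) \<le> (\<Sum>v\<in>V. measure_pmf.prob ?p (?S v))"
      by (intro measure_UNION_le finV) auto
    also have "\<dots> \<le> (\<Sum>v\<in>V. (4 / 5) ^ D)" by (intro sum_mono prob_spoiled_le)
    finally show "measure_pmf.prob ?p (\<Union>v\<in>V. ?S v) \<le> real (card V) * (4 / 5) ^ D" by simp
  qed
  finally show ?thesis by (simp add: algebra_simps)
qed

end

section \<open>Main theorem\<close>

lemma exec_mis_alg:
  assumes "finite V"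
  shows "exec (mis_alg k l q1 q2 (slot_pmf l' L R r)) V E T =
    map_pmf (\<lambda>\<sigma>. det_run (mis_alg k l q1 q2 (slot_pmf l' L R r)) (mis_trans k l q1 q2) V E
        (\<lambda>v. if v \<in> V then (mis_init k v (\<sigma> v), 0) else undefined) T)
      (slots V l' L R r)"
proof -
  let ?A = "mis_alg k l q1 q2 (slot_pmf l' L R r)"
  have "exec ?A V E 0 = Pi_pmf V undefined (\<lambda>v. map_pmf (\<lambda>s. (mis_init k v s, 0)) (slot_pmf l' L R r))"
    by (simp add: mis_alg_def pmf.map_comp o_def)
  also have "\<dots> = map_pmf (\<lambda>\<sigma> v. if v \<in> V then (mis_init k v (\<sigma> v), 0) else undefined) (slots V l' L R r)"
    by (rule Pi_pmf_map_dep[OF assms])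
  finally have 0: "exec ?A V E 0 = \<dots>" .
  show ?thesis
    by (subst exec_det[OF assms, where \<delta> = "mis_trans k l q1 q2"])
      (simp_all only: 0 pmf.map_comp o_def, simp add: mis_alg_def)
qed

text \<open>The constants 33 and 10 are the least that make \<open>(15 / 16) ^ 33\<close> and
  \<open>(4 / 5) ^ 10\<close> at most 1/8. With \<open>n = card V\<close> the failure probability is
  then at most n (l + 2) / 8^l, which n <= 2^l and l + 2 <= 2^l bring below 1/n.\<close>

lemma mis_alg_correct:
  fixes V :: "nat set" and l :: nat
  defines "L \<equiv> 33 * l" and "D \<equiv> 10 * l"
  defines "R \<equiv> Suc l * L"
  assumes sg: "simple_graph V E" and l: "l \<ge> 2" and card_V: "card V \<le> 2 ^ l" "card V > 0" and V: "V \<subseteq> {..<2 ^ l}"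
    and q: "prime q1" "prime q2" "D * l < q1" "D * 3 < q2" "q1\<^sup>2 \<le> q2 ^ 4" "q1\<^sup>2 \<le> 2 ^ l" "q2\<^sup>2 \<le> 2 ^ k"
    and k: "R < 2 ^ k" and T: "T \<ge> 2 * 2 ^ Suc k + 2"
  defines "A \<equiv> mis_alg k l q1 q2 (slot_pmf l L R R)"
  shows "AE cf in measure_pmf (exec A V E T).
      (\<forall>v\<in>V. a_wake A (fst (cf v)) = None \<and> snd (cf v) \<le> 2 * k + 6) \<and>
      independent_set V E (output_set A V cf)"
    and "measure_pmf.prob (exec A V E T) {cf. maximal_independent_set V E (output_set A V cf)}
      \<ge> 1 - 1 / real (card V)"
proof -
  have finV: "finite V" using sg by (simp add: simple_graph_def)
  let ?p = "slots V l L R R"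
  let ?c0 = "\<lambda>\<sigma> v. if v \<in> V then (mis_init k v (\<sigma> v), 0 :: nat) else undefined"
  define F where "F \<sigma> = det_run A (mis_trans k l q1 q2) V E (?c0 \<sigma>) T" for \<sigma>
  have exec: "exec A V E T = map_pmf F ?p"
    unfolding A_def F_def by (rule exec_mis_alg[OF finV])
  have slot_less: "\<sigma> v < 2 ^ k" if "\<sigma> \<in> set_pmf ?p" "v \<in> V" for \<sigma> v
  proof -
    have "\<sigma> \<in> PiE_dflt V R (set_pmf \<circ> (\<lambda>_. slot_pmf l L R R))" using that(1) set_Pi_pmf[OF finV] by metis
    then have "\<sigma> v \<in> insert R {..<R}" using that(2) set_slot_pmf[of l L R R] by (auto simp: PiE_dflt_def)
    then show ?thesis using k by auto
  qed
  have run: "v \<in> V \<Longrightarrow> a_wake A (fst (F \<sigma> v)) = None" "v \<in> V \<Longrightarrow> snd (F \<sigma> v) \<le> 2 * k + 6"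
    "output_set A V (F \<sigma>) = mis_result V E k l q1 q2 \<sigma>" if \<sigma>: "\<sigma> \<in> set_pmf ?p" for \<sigma> v
  proof -
    have c0: "?c0 \<sigma> v = (mis_init k v (\<sigma> v), 0)" if "v \<in> V" for v using that by simp
    note run = mis_run[OF sg slot_less[OF \<sigma>] c0 T]
    show "v \<in> V \<Longrightarrow> a_wake A (fst (F \<sigma> v)) = None" "v \<in> V \<Longrightarrow> snd (F \<sigma> v) \<le> 2 * k + 6"
      "output_set A V (F \<sigma>) = mis_result V E k l q1 q2 \<sigma>"
      unfolding A_def F_def by (rule run; assumption)+
  qed
  show "AE cf in measure_pmf (exec A V E T).
      (\<forall>v\<in>V. a_wake A (fst (cf v)) = None \<and> snd (cf v) \<le> 2 * k + 6) \<and>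
      independent_set V E (output_set A V cf)"
    unfolding exec AE_measure_pmf_iff using run independent_mis_result[OF sg] by auto
  let ?J = "\<lambda>\<sigma>. slot_greedy V E \<sigma> {} (2 ^ k)"
  let ?bad = "{\<sigma>. \<exists>v. undominated V E (?J \<sigma>) v \<and> card (residual_nbrs V E (?J \<sigma>) v) > D}"
  have V': "V \<subseteq> {..<q1 ^ Suc l}"
  proof -
    have "(2::nat) ^ l \<le> q1 ^ l" using q(1) prime_ge_2_nat by (intro power_mono) auto
    also have "\<dots> \<le> q1 ^ Suc l" using q(1) prime_ge_1_nat by (intro power_increasing) auto
    finally show ?thesis using V by auto
  qed
  have good: "- ?bad \<inter> set_pmf ?p \<subseteq> F -` {cf. maximal_independent_set V E (output_set A V cf)}"
  proof
    fix \<sigma> assume "\<sigma> \<in> - ?bad \<inter> set_pmf ?p"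
    then have \<sigma>: "\<sigma> \<in> set_pmf ?p" and "\<sigma> \<notin> ?bad" by simp_all
    then have "card (residual_nbrs V E (?J \<sigma>) v) \<le> D" if "undominated V E (?J \<sigma>) v" for v
      using that by (auto simp: not_less)
    then have "maximal_independent_set V E (mis_result V E k l q1 q2 \<sigma>)"
      by (intro maximal_mis_result[OF sg q V'])
    then show "\<sigma> \<in> F -` {cf. maximal_independent_set V E (output_set A V cf)}" using run(3)[OF \<sigma>] by simp
  qed
  have pow: "(15 / 16 :: real) ^ L \<le> (1 / 8) ^ l" "(4 / 5 :: real) ^ D \<le> (1 / 8) ^ l"
    unfolding L_def D_def power_mult by (intro power_mono; simp add: power_divide)+
  have "measure_pmf.prob ?p ?bad \<le> real (card V) * (real (Suc l) * (15 / 16) ^ L + (4 / 5) ^ D)"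
    using k l by (intro prob_residual_degree_le[OF sg _ _ card_V(1)]) (auto simp: L_def R_def)
  also have "\<dots> \<le> real (card V) * (real (Suc l) * (1 / 8) ^ l + (1 / 8) ^ l)"
    using pow by (intro mult_left_mono add_mono) auto
  also have "\<dots> = real (card V) * real (l + 2) * (1 / 8) ^ l" by (simp add: algebra_simps)
  also have "\<dots> \<le> 1 / real (card V)"
  proof -
    have l2: "l + 2 \<le> 2 ^ l" using l by (induction l rule: dec_induct) auto
    have "card V * card V * (l + 2) \<le> 2 ^ l * 2 ^ l * 2 ^ l"
      by (intro mult_le_mono card_V l2)
    also have "\<dots> = 8 ^ l" by (simp add: power_mult_distrib[symmetric])
    finally have "real (card V * card V * (l + 2)) \<le> real (8 ^ l)" by (simp only: of_nat_le_iff)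
    then show ?thesis using card_V(2) by (simp add: field_simps power_divide)
  qed
  finally have "1 - 1 / real (card V) \<le> 1 - measure_pmf.prob ?p ?bad" by simp
  also have "\<dots> = measure_pmf.prob ?p (- ?bad)"
    using measure_pmf.prob_compl[of ?bad ?p] by (simp add: Compl_eq_Diff_UNIV)
  also have "\<dots> = measure_pmf.prob ?p (- ?bad \<inter> set_pmf ?p)" by (rule measure_Int_set_pmf[symmetric])
  also have "\<dots> \<le> measure_pmf.prob ?p (F -` {cf. maximal_independent_set V E (output_set A V cf)})"
    using good by (intro measure_pmf.finite_measure_mono) auto
  also have "\<dots> = measure_pmf.prob (exec A V E T) {cf. maximal_independent_set V E (output_set A V cf)}"
    unfolding exec by simp
  finally show "measure_pmf.prob (exec A V E T) {cf. maximal_independent_set V E (output_set A V cf)}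
      \<ge> 1 - 1 / real (card V)" .
qed

lemma congest_mis_alg:
  assumes "N \<ge> 2" "real l \<le> log 2 (real N) + 1"
  shows "congest 2 N (mis_alg k l q1 q2 P)"
  unfolding congest_def
proof (intro allI impI)
  fix s u m assume "a_send (mis_alg k l q1 q2 P) s u = Some m"
  then have "length m = l"
    by (auto simp: mis_alg_def mis_send_def encode_nat_def split: list.splits if_splits)
  moreover have "log 2 2 \<le> log 2 (real N)" using assms(1) by (intro log_mono) auto
  ultimately show "real (length m) \<le> 2 * log 2 (real N)" using assms(2) by simp
qed

text \<open>Here \<open>q1\<close> lies in (10 l^2, 40 l^2] and \<open>q2\<close> in (30 l, 120 l].
  So \<open>q1\<close> is at most (30 l)^2, hence at most \<open>q2\<^sup>2\<close>, while q1^2 <=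
  1600 l^4 <= 2^l for large \<open>l\<close>. The least power of two from 14400 l^2 on is at most
  28800 l^2 and also exceeds the number of first-phase slots.\<close>

lemma eventually_parameters:
  "eventually (\<lambda>l::nat. l \<ge> 2 \<and> (\<exists>q1 q2 k. prime q1 \<and> prime q2 \<and> 10 * l * l < q1 \<and> 10 * l * 3 < q2 \<and>
     q1\<^sup>2 \<le> q2 ^ 4 \<and> q1\<^sup>2 \<le> 2 ^ l \<and> q2\<^sup>2 \<le> 2 ^ k \<and> Suc l * (33 * l) < 2 ^ k \<and> 2 ^ k \<le> 28800 * l\<^sup>2)) at_top"
proof -
  have sq: "filterlim (\<lambda>l::nat. 10 * l * l) at_top at_top" "filterlim (\<lambda>l::nat. 10 * l * 3) at_top at_top"
    by (rule filterlim_at_top_mono[OF filterlim_ident], rule eventually_mono[OF eventually_ge_at_top[of 1]], simp)+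
  have "eventually (\<lambda>l::nat. 1600 * real l ^ 4 \<le> 2 ^ l) at_top" by real_asymp
  then show ?thesis
    using eventually_ge_at_top[of 2] eventually_compose_filterlim[OF eventually_prime_between sq(1)]
      eventually_compose_filterlim[OF eventually_prime_between sq(2)]
  proof eventually_elim
    case (elim l)
    then obtain q1 q2 where q: "prime q1" "10 * l * l < q1" "q1 \<le> 4 * (10 * l * l)"
      "prime q2" "10 * l * 3 < q2" "q2 \<le> 4 * (10 * l * 3)" by auto
    have "q1\<^sup>2 \<le> (40 * l\<^sup>2)\<^sup>2" using q(3) by (intro power_mono) (auto simp: power2_eq_square)
    also have "\<dots> = 1600 * l ^ 4" by (simp add: power_mult_distrib)
    also have "\<dots> \<le> 2 ^ l"
    proof -
      have "real (1600 * l ^ 4) \<le> real (2 ^ l)" using elim(1) by simp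
      then show ?thesis by (simp only: of_nat_le_iff)
    qed
    finally have a: "q1\<^sup>2 \<le> 2 ^ l" .
    have "q1 \<le> (30 * l)\<^sup>2" using q(3) by (simp add: power2_eq_square)
    also have "\<dots> \<le> q2\<^sup>2" using q(5) by (intro power_mono) auto
    finally have "q1\<^sup>2 \<le> (q2\<^sup>2)\<^sup>2" by (rule power_mono) simp
    then have b: "q1\<^sup>2 \<le> q2 ^ 4" by simp
    have "q2\<^sup>2 \<le> (120 * l)\<^sup>2" using q(6) by (intro power_mono) auto
    then have c: "q2\<^sup>2 \<le> 14400 * l\<^sup>2" by (simp add: power_mult_distrib)
    define k where "k = (LEAST k. 14400 * l\<^sup>2 \<le> 2 ^ k)"
    have "14400 * l\<^sup>2 \<le> 2 ^ (14400 * l\<^sup>2)" using less_exp[of "14400 * l\<^sup>2"] by simp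
    then have k: "14400 * l\<^sup>2 \<le> 2 ^ k" unfolding k_def by (rule LeastI)
    have ll: "l \<le> l\<^sup>2" "l\<^sup>2 > 0" using elim(2) by (auto simp: power2_eq_square)
    then have "k \<noteq> 0" using k by (intro notI) simp
    then have "\<not> 14400 * l\<^sup>2 \<le> 2 ^ (k - 1)" unfolding k_def by (intro not_less_Least) simp
    moreover have "(2::nat) ^ k = 2 * 2 ^ (k - 1)" using \<open>k \<noteq> 0\<close> by (cases k) auto
    ultimately have d: "2 ^ k \<le> 28800 * l\<^sup>2" by linarith
    have "Suc l * (33 * l) = 33 * l\<^sup>2 + 33 * l" by (simp add: power2_eq_square)
    then have "Suc l * (33 * l) < 14400 * l\<^sup>2" using ll by linarith
    then have "Suc l * (33 * l) < 2 ^ k" "q2\<^sup>2 \<le> 2 ^ k" using c k by linarith+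
    then show ?case using q a b d elim(2) by blast
  qed
qed

theorem theorem1p1:
  fixes c0 :: nat
  assumes "c0 \<ge> 1"
  shows "\<exists>(Alg :: nat \<Rightarrow> algorithm) (B :: real) (Ct :: real) (Ce :: real) (c :: real) (n0 :: nat).
     c > 0 \<and>
     (\<forall>N n V E. n \<ge> n0 \<and> n \<le> N \<and> N \<le> n ^ c0 \<and> V \<subseteq> {..<N} \<and> card V = n \<and>
        simple_graph V E \<longrightarrow>
        (let A = Alg N; T = nat \<lceil>Ct * (log 2 (real n))\<^sup>2\<rceil> in
          congest B N A \<and>
          (AE cf in measure_pmf (exec A V E T).
             (\<forall>v\<in>V. a_wake A (fst (cf v)) = None \<and>
                    real (snd (cf v)) \<le> Ce * log 2 (log 2 (real n))) \<and>
             independent_set V E (output_set A V cf)) \<and>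
          measure_pmf.prob (exec A V E T)
             {cf. maximal_independent_set V E (output_set A V cf)} \<ge> 1 - real n powr (- c)))"
proof -
  obtain l0 where "\<forall>l\<ge>l0. l \<ge> 2 \<and> (\<exists>q1 q2 k. prime q1 \<and> prime q2 \<and> 10 * l * l < q1 \<and> 10 * l * 3 < q2 \<and>
     q1\<^sup>2 \<le> q2 ^ 4 \<and> q1\<^sup>2 \<le> 2 ^ l \<and> q2\<^sup>2 \<le> 2 ^ k \<and> Suc l * (33 * l) < 2 ^ k \<and> 2 ^ k \<le> 28800 * l\<^sup>2)"
    using eventually_parameters unfolding eventually_at_top_linorder by blast
  then obtain q1 q2 k where par: "\<And>l. l \<ge> l0 \<Longrightarrow> l \<ge> 2 \<and> prime (q1 l) \<and> prime (q2 l) \<and>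
      10 * l * l < q1 l \<and> 10 * l * 3 < q2 l \<and> (q1 l)\<^sup>2 \<le> q2 l ^ 4 \<and> (q1 l)\<^sup>2 \<le> 2 ^ l \<and> (q2 l)\<^sup>2 \<le> 2 ^ k l \<and>
      Suc l * (33 * l) < 2 ^ k l \<and> 2 ^ k l \<le> 28800 * l\<^sup>2"
    by metis
  define len where "len N = nat \<lceil>log 2 (real N)\<rceil>" for N
  define alg where "alg l = mis_alg (k l) l (q1 l) (q2 l)
    (slot_pmf l (33 * l) (Suc l * (33 * l)) (Suc l * (33 * l)))" for l
  \<comment> \<open>From N <= n^c0 follows \<open>len N <= (c0 + 1) * log 2 n\<close>, so
    \<open>C\<close> times the squared logarithm of n bounds \<open>2 ^ k\<close>. The factor 5 in
    the running time covers 2 * 2^(k + 1) + 2 <= 5 * 2^k.\<close>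
  define C where "C = 28800 * (real c0 + 1)\<^sup>2"
  \<comment> \<open>With x the logarithm of n: the first condition makes \<open>len N\<close> at
    least \<open>l0\<close>, the second gives k <= log (C x^2) <= 3 log x, and the third absorbs the
    additive 6, so that 2k + 6 <= 8 log x.\<close>
  have "eventually (\<lambda>n::nat. log 2 (real n) \<ge> real l0 + 1 \<and> log 2 (real n) \<ge> C \<and> log 2 (log 2 (real n)) \<ge> 3) at_top"
    by (intro eventually_conj; real_asymp)
  then obtain n0 where n0: "\<And>n. n \<ge> n0 \<Longrightarrow> log 2 (real n) \<ge> real l0 + 1 \<and> log 2 (real n) \<ge> C \<and> log 2 (log 2 (real n)) \<ge> 3"
    unfolding eventually_at_top_linorder by blast
  have main: "congest 2 N (alg (len N)) \<and>
      (AE cf in measure_pmf (exec (alg (len N)) V E T).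
         (\<forall>v\<in>V. a_wake (alg (len N)) (fst (cf v)) = None \<and>
                real (snd (cf v)) \<le> 8 * log 2 (log 2 (real n))) \<and>
         independent_set V E (output_set (alg (len N)) V cf)) \<and>
      measure_pmf.prob (exec (alg (len N)) V E T)
         {cf. maximal_independent_set V E (output_set (alg (len N)) V cf)} \<ge> 1 - real n powr (- 1)"
    if n: "n \<ge> n0" "n \<le> N" "N \<le> n ^ c0" and V: "V \<subseteq> {..<N}" "card V = n" "simple_graph V E"
      and T: "T = nat \<lceil>5 * C * (log 2 (real n))\<^sup>2\<rceil>" for N n V E T
  proof -
    let ?x = "log 2 (real n)" and ?l = "len N"
    have x: "?x \<ge> real l0 + 1" "?x \<ge> C" "log 2 ?x \<ge> 3" using n0[OF n(1)] by auto
    have n_pos: "n \<ge> 2"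
    proof (rule ccontr)
      assume "\<not> n \<ge> 2"
      then have "n = 0 \<or> n = 1" by auto
      then show False using x(1) by (auto simp: log_def)
    qed
    have xN: "?x \<le> log 2 (real N)" using n n_pos by (intro log_mono) auto
    have Nx: "log 2 (real N) \<le> real c0 * ?x"
    proof -
      have "log 2 (real N) \<le> log 2 (real (n ^ c0))" using n n_pos by (intro log_mono) (auto simp del: of_nat_power)
      also have "\<dots> = real c0 * ?x" using n_pos by (simp add: log_nat_power)
      finally show ?thesis .
    qed
    have len: "log 2 (real N) \<le> real ?l" "real ?l \<le> log 2 (real N) + 1"
      using xN x(1) unfolding len_def by linarith+
    have "?l \<ge> l0" using len xN x(1) by linarith
    note p = par[OF this]
    have N_le: "N \<le> 2 ^ ?l"
    proof -
      have "real N = 2 powr log 2 (real N)" using n n_pos by simp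
      also have "\<dots> \<le> 2 powr real ?l" using len by (intro powr_mono) auto
      also have "\<dots> = real (2 ^ ?l)" by (simp add: powr_realpow)
      finally show ?thesis by (simp only: of_nat_le_iff)
    qed
    have l_le: "real ?l \<le> (real c0 + 1) * ?x"
      using len Nx x(1) by (simp add: algebra_simps)
    have k_le: "2 ^ k ?l \<le> C * ?x\<^sup>2"
    proof -
      have "real (2 ^ k ?l) \<le> real (28800 * ?l\<^sup>2)" using p by (simp only: of_nat_le_iff)
      also have "\<dots> = 28800 * (real ?l)\<^sup>2" by simp
      also have "\<dots> \<le> 28800 * ((real c0 + 1) * ?x)\<^sup>2" using l_le by (intro mult_left_mono power_mono) auto
      also have "\<dots> = C * ?x\<^sup>2" by (simp add: C_def power_mult_distrib)
      finally show ?thesis by simp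
    qed
    have x0: "?x > 0" using x(1) by linarith
    have T_ge: "T \<ge> 2 * 2 ^ Suc (k ?l) + 2"
    proof -
      have "k ?l \<noteq> 0" using p by (intro notI) auto
      then have "2 ^ 1 \<le> (2::nat) ^ k ?l" by (intro power_increasing) auto
      then have "(2::real) ^ 1 \<le> 2 ^ k ?l" by (metis of_nat_le_iff of_nat_numeral of_nat_power)
      then have "real (2 * 2 ^ Suc (k ?l) + 2) \<le> 5 * 2 ^ k ?l" by simp
      also have "\<dots> \<le> 5 * C * ?x\<^sup>2" using k_le by simp
      also have "\<dots> \<le> real T" unfolding T by (rule real_nat_ceiling_ge)
      finally show ?thesis by (simp only: of_nat_le_iff)
    qed
    have energy: "real (2 * k ?l + 6) \<le> 8 * log 2 ?x"
    proof -
      have "C \<ge> 28800" unfolding C_def by (simp add: power2_eq_square algebra_simps)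
      have "real (k ?l) = log 2 (2 ^ k ?l)" by simp
      also have "\<dots> \<le> log 2 (C * ?x\<^sup>2)" using k_le by (intro log_mono) auto
      also have "\<dots> \<le> log 2 (?x * ?x\<^sup>2)" using x(2) x0 \<open>C \<ge> 28800\<close> by (intro log_mono mult_right_mono) auto
      also have "\<dots> = log 2 (?x ^ 3)" by (simp add: power_numeral_reduce)
      also have "\<dots> = 3 * log 2 ?x" using x0 by (simp add: log_nat_power)
      finally show ?thesis using x(3) by simp
    qed
    have card: "card V \<le> 2 ^ ?l" "card V > 0" "V \<subseteq> {..<2 ^ ?l}"
      using V n N_le n_pos by auto
    have "congest 2 N (alg ?l)"
      unfolding alg_def using n n_pos len by (intro congest_mis_alg) auto
    moreover have "AE cf in measure_pmf (exec (alg ?l) V E T).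
        (\<forall>v\<in>V. a_wake (alg ?l) (fst (cf v)) = None \<and> snd (cf v) \<le> 2 * k ?l + 6) \<and>
        independent_set V E (output_set (alg ?l) V cf)"
      unfolding alg_def using p T_ge card V(3) by (intro mis_alg_correct(1)) auto
    then have "AE cf in measure_pmf (exec (alg ?l) V E T).
        (\<forall>v\<in>V. a_wake (alg ?l) (fst (cf v)) = None \<and> real (snd (cf v)) \<le> 8 * log 2 ?x) \<and>
        independent_set V E (output_set (alg ?l) V cf)"
    proof (rule AE_mp, intro AE_I2 impI conjI ballI)
      fix cf v
      assume *: "(\<forall>v\<in>V. a_wake (alg ?l) (fst (cf v)) = None \<and> snd (cf v) \<le> 2 * k ?l + 6) \<and>
        independent_set V E (output_set (alg ?l) V cf)" and v: "v \<in> V"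
      then have "real (snd (cf v)) \<le> real (2 * k ?l + 6)" by (simp only: of_nat_le_iff)
      then show "real (snd (cf v)) \<le> 8 * log 2 ?x" using energy by linarith
    qed auto
    moreover have "measure_pmf.prob (exec (alg ?l) V E T)
         {cf. maximal_independent_set V E (output_set (alg ?l) V cf)} \<ge> 1 - 1 / real (card V)"
      unfolding alg_def using p T_ge card V(3) by (intro mis_alg_correct(2)) auto
    moreover have "real n powr (- 1) = 1 / real (card V)" using n_pos V by (simp add: powr_minus_divide)
    ultimately show ?thesis by simp
  qed
  show ?thesis
    by (rule exI[of _ "\<lambda>N. alg (len N)"], rule exI[of _ 2], rule exI[of _ "5 * C"], rule exI[of _ 8],
        rule exI[of _ 1], rule exI[of _ n0], unfold Let_def)
      (use main in \<open>simp only: zero_less_one simp_thms; blast\<close>)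
qed

end
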